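(* Let $k$ be an algebraically closed field, let $M$ be a finite monoid with group of units $G$, and let $V$ be a nonzero finite-dimensional $kM$-module on which no element of $M$ apart from $1$ acts as the identity. Let $n_0$ be the smallest natural number such that $V^{\otimes n_0}$ has a composition factor of the form $\mathrm{Ind}(W)$ with $W$ a simple $kG$-module. Then $n_0\le L-1$, where $L$ is the number of $\mathcal L$-classes of $M$.
   Context: For a $kG$-module $W$, $\mathrm{Ind}(W)$ is the $kM$-module with underlying space $W$ on which $G$ acts as given and all elements of $M\setminus G$ act as $0$. Modules are unital left modules; $V^{\otimes n}$ carries the diagonal action of $M$, and $V^{\otimes0}=k$ is the trivial module (all elements of $M$ act as identity); natural numbers include $0$. Two elements $x,y\in M$ are $\mathcal L$-equivalent if $Mx=My$. *)

theory Defs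
  imports
    "HOL-Algebra.Algebraic_Closure"
    "Jordan_Normal_Form.Missing_VectorSpace"
begin

text \<open>
  A unital left module over the monoid algebra \<open>KM\<close> is given by its underlying \<open>K\<close>-vector space
  together with the action of the basis \<open>M\<close> of \<open>KM\<close>, which is by \<open>K\<close>-linear maps.
\<close>

record ('k, 'm, 'v) monoid_module = "('k, 'v) module" +
  act :: "'m \<Rightarrow> 'v \<Rightarrow> 'v"

locale monoid_module =
  M?: monoid M + V?: vectorspace K V
  for K :: "('k, 'r) ring_scheme"
    and M :: "('m, 's) monoid_scheme"
    and V :: "('k, 'm, 'v) monoid_module" +
  assumes act_closed:
      "\<lbrakk>m \<in> carrier M; v \<in> carrier V\<rbrakk> \<Longrightarrow> act V m v \<in> carrier V"
    and act_add:
      "\<lbrakk>m \<in> carrier M; v \<in> carrier V; w \<in> carrier V\<rbrakk> \<Longrightarrow>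
        act V m (v \<oplus>\<^bsub>V\<^esub> w) = act V m v \<oplus>\<^bsub>V\<^esub> act V m w"
    and act_smult:
      "\<lbrakk>m \<in> carrier M; a \<in> carrier K; v \<in> carrier V\<rbrakk> \<Longrightarrow>
        act V m (a \<odot>\<^bsub>V\<^esub> v) = a \<odot>\<^bsub>V\<^esub> act V m v"
    and act_one:
      "v \<in> carrier V \<Longrightarrow> act V \<one>\<^bsub>M\<^esub> v = v"
    and act_mult:
      "\<lbrakk>m \<in> carrier M; m' \<in> carrier M; v \<in> carrier V\<rbrakk> \<Longrightarrow>
        act V (m \<otimes>\<^bsub>M\<^esub> m') v = act V m (act V m' v)"

definition monoid_submodule ::
  "('k, 'r) ring_scheme \<Rightarrow> ('m, 's) monoid_scheme \<Rightarrow> 'v set \<Rightarrow> ('k, 'm, 'v) monoid_module \<Rightarrow> bool"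
  where "monoid_submodule K M U V \<longleftrightarrow>
    subspace K U V \<and> (\<forall>m\<in>carrier M. \<forall>u\<in>U. act V m u \<in> U)"

definition simple_monoid_module ::
  "('k, 'r) ring_scheme \<Rightarrow> ('m, 's) monoid_scheme \<Rightarrow> ('k, 'm, 'v) monoid_module \<Rightarrow> bool"
  where "simple_monoid_module K M V \<longleftrightarrow>
    monoid_module K M V \<and> carrier V \<noteq> {\<zero>\<^bsub>V\<^esub>} \<and>
    (\<forall>U. monoid_submodule K M U V \<longrightarrow> U = {\<zero>\<^bsub>V\<^esub>} \<or> U = carrier V)"

definition monoid_module_iso ::
  "('k, 'r) ring_scheme \<Rightarrow> ('m, 's) monoid_scheme \<Rightarrow>
    ('k, 'm, 'v) monoid_module \<Rightarrow> ('k, 'm, 'w) monoid_module \<Rightarrow> bool"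
  where "monoid_module_iso K M V W \<longleftrightarrow>
    (\<exists>f \<in> module_hom K V W. bij_betw f (carrier V) (carrier W) \<and>
      (\<forall>m\<in>carrier M. \<forall>v\<in>carrier V. f (act V m v) = act W m (f v)))"

text \<open>
  As for factor rings in the library, the operations on cosets are written as unions over
  representatives; for a submodule \<open>U\<close> they are \<open>a \<odot> (U + v) = U + a \<odot> v\<close> and
  \<open>m (U + v) = U + m v\<close>. The fields \<open>mult\<close> and \<open>one\<close>, present because modules extend rings, are
  irrelevant.
\<close>

definition quotient_module ::
  "('k, 'm, 'v) monoid_module \<Rightarrow> 'v set \<Rightarrow> ('k, 'm, 'v set) monoid_module"
  where "quotient_module V U =
    \<lparr>carrier = a_rcosets\<^bsub>V\<^esub> U,
     monoid.mult = (\<lambda>A B. U),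
     one = U,
     zero = U,
     add = set_add V,
     smult = (\<lambda>a A. \<Union>x\<in>A. U +>\<^bsub>V\<^esub> (a \<odot>\<^bsub>V\<^esub> x)),
     act = (\<lambda>m A. \<Union>x\<in>A. U +>\<^bsub>V\<^esub> act V m x)\<rparr>"

definition composition_series ::
  "('k, 'r) ring_scheme \<Rightarrow> ('m, 's) monoid_scheme \<Rightarrow> ('k, 'm, 'v) monoid_module \<Rightarrow>
    nat \<Rightarrow> (nat \<Rightarrow> 'v set) \<Rightarrow> bool"
  where "composition_series K M V l C \<longleftrightarrow>
    C 0 = {\<zero>\<^bsub>V\<^esub>} \<and> C l = carrier V \<and>
    (\<forall>i\<le>l. monoid_submodule K M (C i) V) \<and>
    (\<forall>i<l. C i \<subseteq> C (Suc i) \<and>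
      simple_monoid_module K M (quotient_module (V\<lparr>carrier := C (Suc i)\<rparr>) (C i)))"

definition composition_factor ::
  "('k, 'r) ring_scheme \<Rightarrow> ('m, 's) monoid_scheme \<Rightarrow>
    ('k, 'm, 'w) monoid_module \<Rightarrow> ('k, 'm, 'v) monoid_module \<Rightarrow> bool"
  where "composition_factor K M S V \<longleftrightarrow>
    (\<exists>l C i. composition_series K M V l C \<and> i < l \<and>
      monoid_module_iso K M S (quotient_module (V\<lparr>carrier := C (Suc i)\<rparr>) (C i)))"

definition Ind ::
  "('m, 's) monoid_scheme \<Rightarrow> ('k, 'm, 'v) monoid_module \<Rightarrow> ('k, 'm, 'v) monoid_module"
  where "Ind M W =
    W\<lparr>act := (\<lambda>m w. if m \<in> Units M then act W m w else \<zero>\<^bsub>W\<^esub>)\<rparr>"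

text \<open>
  The tensor power \<open>V\<^sup>\<otimes>\<^sup>n\<close> is the quotient of the free vector space on \<open>n\<close>-tuples of vectors
  by the relations of multilinearity. A tuple is a list of length \<open>n\<close>, an element of the free
  space is a finitely supported coefficient function, and \<open>m\<close> acts on the basis by
  \<open>[v\<^sub>1, \<dots>, v\<^sub>n] \<mapsto> [m v\<^sub>1, \<dots>, m v\<^sub>n]\<close>.
  For \<open>n = 0\<close> the only tuple is \<open>[]\<close> and there are no relations, so that the result is \<open>K\<close>
  with trivial action.
\<close>

definition tuples :: "('k, 'm, 'v) monoid_module \<Rightarrow> nat \<Rightarrow> 'v list set"
  where "tuples V n = {xs. length xs = n \<and> set xs \<subseteq> carrier V}"

definition free_tensors ::
  "('k, 'r) ring_scheme \<Rightarrow> ('k, 'm, 'v) monoid_module \<Rightarrow> nat \<Rightarrow>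
    ('k, 'm, 'v list \<Rightarrow> 'k) monoid_module"
  where "free_tensors K V n =
    \<lparr>carrier = {f. (\<forall>xs\<in>tuples V n. f xs \<in> carrier K) \<and>
                   (\<forall>xs. xs \<notin> tuples V n \<longrightarrow> f xs = \<zero>\<^bsub>K\<^esub>) \<and>
                   finite {xs. f xs \<noteq> \<zero>\<^bsub>K\<^esub>}},
     monoid.mult = (\<lambda>f g xs. \<zero>\<^bsub>K\<^esub>),
     one = (\<lambda>xs. \<zero>\<^bsub>K\<^esub>),
     zero = (\<lambda>xs. \<zero>\<^bsub>K\<^esub>),
     add = (\<lambda>f g xs. f xs \<oplus>\<^bsub>K\<^esub> g xs),
     smult = (\<lambda>a f xs. a \<otimes>\<^bsub>K\<^esub> f xs),
     act = (\<lambda>m f ys. \<Oplus>\<^bsub>K\<^esub>xs\<in>{xs. f xs \<noteq> \<zero>\<^bsub>K\<^esub> \<and> map (act V m) xs = ys}. f xs)\<rparr>"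

definition tuple_vec :: "('k, 'r) ring_scheme \<Rightarrow> 'v list \<Rightarrow> 'v list \<Rightarrow> 'k"
  where "tuple_vec K xs = (\<lambda>ys. if ys = xs then \<one>\<^bsub>K\<^esub> else \<zero>\<^bsub>K\<^esub>)"

definition multilinear_relations ::
  "('k, 'r) ring_scheme \<Rightarrow> ('k, 'm, 'v) monoid_module \<Rightarrow> nat \<Rightarrow> ('v list \<Rightarrow> 'k) set"
  where "multilinear_relations K V n =
    (let F = free_tensors K V n; t = tuple_vec K in
      {t (xs[i := u \<oplus>\<^bsub>V\<^esub> v]) \<ominus>\<^bsub>F\<^esub> (t (xs[i := u]) \<oplus>\<^bsub>F\<^esub> t (xs[i := v])) | xs i u v.
        xs \<in> tuples V n \<and> i < n \<and> u \<in> carrier V \<and> v \<in> carrier V} \<union>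
      {t (xs[i := a \<odot>\<^bsub>V\<^esub> u]) \<ominus>\<^bsub>F\<^esub> (a \<odot>\<^bsub>F\<^esub> t (xs[i := u])) | xs i a u.
        xs \<in> tuples V n \<and> i < n \<and> a \<in> carrier K \<and> u \<in> carrier V})"

definition tensor_power ::
  "('k, 'r) ring_scheme \<Rightarrow> ('k, 'm, 'v) monoid_module \<Rightarrow> nat \<Rightarrow>
    ('k, 'm, ('v list \<Rightarrow> 'k) set) monoid_module"
  where "tensor_power K V n =
    quotient_module (free_tensors K V n)
      (module.span K (free_tensors K V n) (multilinear_relations K V n))"

text \<open>
  In \<open>has_ind_factor\<close> the module \<open>W\<close> lives on the type of the composition factors themselves.
  This is no restriction: \<open>Ind(W)\<close> has the same underlying space as \<open>W\<close>, so the structure can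
  be transported along the isomorphism.
\<close>

definition has_ind_factor ::
  "('k, 'r) ring_scheme \<Rightarrow> ('m, 's) monoid_scheme \<Rightarrow> ('k, 'm, 'v) monoid_module \<Rightarrow> bool"
  where "has_ind_factor K M V \<longleftrightarrow>
    (\<exists>W :: ('k, 'm, 'v set) monoid_module.
      simple_monoid_module K (units_of M) W \<and> composition_factor K M (Ind M W) V)"

definition L_equiv :: "('m, 's) monoid_scheme \<Rightarrow> ('m \<times> 'm) set"
  where "L_equiv M =
    {(x, y). x \<in> carrier M \<and> y \<in> carrier M \<and> carrier M #>\<^bsub>M\<^esub> x = carrier M #>\<^bsub>M\<^esub> y}"

definition L_classes :: "('m, 's) monoid_scheme \<Rightarrow> 'm set set"
  where "L_classes M = carrier M // L_equiv M"

end

theory Submission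
  imports Defs
begin

text \<open>
  A nonunit \<open>s\<close> of \<open>M\<close> is not injective on \<open>V\<close>: otherwise some power \<open>s\<^sup>d\<close> with \<open>d > 0\<close> would
  act as the identity, so that \<open>s\<^sup>d = 1\<close>. The kernel of \<open>s\<close> depends only on the \<open>\<L>\<close>-class of
  \<open>s\<close>, so a single nonzero vector is annihilated by a whole \<open>\<L>\<close>-class of nonunits. The units form
  one \<open>\<L>\<close>-class; the tensor product of the vectors chosen for the \<open>L - 1\<close> other classes is a
  nonzero element of the tensor power of exponent \<open>L - 1\<close> annihilated by all nonunits. A minimal
  nonzero submodule of the space of all such elements is simple of the form \<open>Ind(W)\<close>, and it is the
  bottom of a composition series.
\<close>

text \<open>Finiteness of M enters more than once. It makes every one-sided invertible element a
  unit, so s m is a nonunit whenever s is. Hence if all nonunits kill v, they also kill m v, and the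
  killed vectors form a submodule. On such a submodule the action of M carries no more information
  than that of G, which is why simplicity over M and over G agree there. A composition factor is a
  factor of some composition series, so no uniqueness of factors is involved: a chosen simple
  submodule only has to be continued to the top. The laborious part is the tensor power, a quotient
  of a free space that is usually infinite-dimensional. Two facts about it are not visible from the
  relations: a tensor of nonzero vectors is nonzero, and the quotient is finite-dimensional, so that
  minimal submodules and composition series exist. If M is a group, the exponent is 0 and the tensor
  used is the empty one, which no nonunit has to kill.\<close>

subsection \<open>Quotient modules\<close>

context monoid_module
begin

lemma monoid_submodule_iff:
  "monoid_submodule K M U V \<longleftrightarrow>
    U \<subseteq> carrier V \<and> \<zero>\<^bsub>V\<^esub> \<in> U \<and> (\<forall>v\<in>U. \<forall>w\<in>U. v \<oplus>\<^bsub>V\<^esub> w \<in> U) \<and>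
    (\<forall>a\<in>carrier K. \<forall>v\<in>U. a \<odot>\<^bsub>V\<^esub> v \<in> U) \<and> (\<forall>m\<in>carrier M. \<forall>v\<in>U. act V m v \<in> U)"
  using V.vectorspace_axioms V.module.module_axioms
  by (auto simp: monoid_submodule_def subspace_def LinearCombinations.submodule_def)

lemma act_zero: "m \<in> carrier M \<Longrightarrow> act V m \<zero>\<^bsub>V\<^esub> = \<zero>\<^bsub>V\<^esub>"
  using act_smult[of m "\<zero>\<^bsub>K\<^esub>" "\<zero>\<^bsub>V\<^esub>"] act_closed[of m "\<zero>\<^bsub>V\<^esub>"] by simp

lemma monoid_submodule_zero: "monoid_submodule K M {\<zero>\<^bsub>V\<^esub>} V"
  by (simp add: monoid_submodule_iff act_zero)

lemma monoid_submodule_carrier: "monoid_submodule K M (carrier V) V"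
  by (simp add: monoid_submodule_iff act_closed)

lemma monoid_module_restrict:
  assumes "monoid_submodule K M N V"
  shows "monoid_module K M (V\<lparr>carrier := N\<rparr>)"
proof -
  have "vectorspace K (V\<lparr>carrier := N\<rparr>)"
    using assms by (auto simp: monoid_submodule_def intro: V.subspace_is_vs)
  moreover have "N \<subseteq> carrier V"
    using assms by (simp add: monoid_submodule_iff)
  ultimately show ?thesis
    using assms
    by (auto simp: monoid_submodule_def monoid_module_def monoid_module_axioms_def subset_iff
        M.monoid_axioms act_add act_smult act_one act_mult)
qed

lemma monoid_submodule_restrict:
  assumes "monoid_submodule K M N V"
  shows "monoid_submodule K M W (V\<lparr>carrier := N\<rparr>) \<longleftrightarrow> W \<subseteq> N \<and> monoid_submodule K M W V"
proof -
  interpret N: monoid_module K M "V\<lparr>carrier := N\<rparr>"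
    by (rule monoid_module_restrict[OF assms])
  show ?thesis
    using assms by (auto simp: N.monoid_submodule_iff monoid_submodule_iff)
qed

end

locale monoid_quotient = monoid_module +
  fixes U
  assumes monoid_submodule: "monoid_submodule K M U V"

text \<open>Makes the coset calculus of additive subgroups available. Closure under negation is not
  among the submodule axioms; it comes from the scalar -1.\<close>

sublocale monoid_quotient \<subseteq> U?: abelian_subgroup U V
proof (rule abelian_subgroupI3)
  have "subspace K U V"
    using monoid_submodule by (simp add: monoid_submodule_def)
  then have U: "U \<subseteq> carrier V" "\<zero>\<^bsub>V\<^esub> \<in> U" "\<And>v w. v \<in> U \<Longrightarrow> w \<in> U \<Longrightarrow> v \<oplus>\<^bsub>V\<^esub> w \<in> U"
    "\<And>a v. a \<in> carrier K \<Longrightarrow> v \<in> U \<Longrightarrow> a \<odot>\<^bsub>V\<^esub> v \<in> U"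
    by (auto simp: subspace_def LinearCombinations.submodule_def)
  have "\<ominus>\<^bsub>V\<^esub> v \<in> U" if "v \<in> U" for v
    using U(4)[of "\<ominus>\<^bsub>K\<^esub> \<one>\<^bsub>K\<^esub>" v] U(1) that by (auto simp: V.module.smult_l_minus subset_iff)
  with U show "additive_subgroup U V"
    by (intro additive_subgroup.intro V.module.M.add.subgroupI) (auto simp: a_inv_def)
  show "abelian_group V" ..
qed

context monoid_quotient
begin

lemma carrier_quotient: "carrier (quotient_module V U) = (\<lambda>v. U +>\<^bsub>V\<^esub> v) ` carrier V"
  by (auto simp: quotient_module_def A_RCOSETS_def RCOSETS_def a_r_coset_def)

lemma coset_in_quotient: "v \<in> carrier V \<Longrightarrow> U +>\<^bsub>V\<^esub> v \<in> carrier (quotient_module V U)"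
  by (simp add: carrier_quotient)

lemma coset_eq_iff:
  assumes "v \<in> carrier V" "w \<in> carrier V"
  shows "U +>\<^bsub>V\<^esub> v = U +>\<^bsub>V\<^esub> w \<longleftrightarrow> v \<oplus>\<^bsub>V\<^esub> \<ominus>\<^bsub>V\<^esub> w \<in> U"
  using assms U.a_rcos_module[of w v] U.a_repr_independence' U.a_rcos_self by metis

lemma coset_eq_self_iff: "v \<in> carrier V \<Longrightarrow> U +>\<^bsub>V\<^esub> v = U \<longleftrightarrow> v \<in> U"
  using U.a_rcos_self[of v] U.a_rcos_const[of v] by auto

lemma zero_quotient: "\<zero>\<^bsub>quotient_module V U\<^esub> = U"
  by (simp add: quotient_module_def)

lemma zero_quotient_coset: "\<zero>\<^bsub>quotient_module V U\<^esub> = U +>\<^bsub>V\<^esub> \<zero>\<^bsub>V\<^esub>"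
  using coset_eq_self_iff[of "\<zero>\<^bsub>V\<^esub>"] by (simp add: zero_quotient)

lemma add_quotient:
  assumes "v \<in> carrier V" "w \<in> carrier V"
  shows "(U +>\<^bsub>V\<^esub> v) \<oplus>\<^bsub>quotient_module V U\<^esub> (U +>\<^bsub>V\<^esub> w) = U +>\<^bsub>V\<^esub> (v \<oplus>\<^bsub>V\<^esub> w)"
  using assms U.a_rcos_sum by (simp add: quotient_module_def)

text \<open>Evaluates the unions over representatives in \<open>quotient_module\<close>, once for
  scalars and elements of M alike: an additive map preserving U sends representatives of one coset
  to vectors that differ by an element of U, so all the sets united are equal.\<close>

lemma Union_cosets:
  assumes v: "v \<in> carrier V"
    and f: "\<And>w. w \<in> carrier V \<Longrightarrow> f w \<in> carrier V"
    and f_add: "\<And>w w'. w \<in> carrier V \<Longrightarrow> w' \<in> carrier V \<Longrightarrow> f (w \<oplus>\<^bsub>V\<^esub> w') = f w \<oplus>\<^bsub>V\<^esub> f w'"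
    and f_U: "\<And>u. u \<in> U \<Longrightarrow> f u \<in> U"
  shows "(\<Union>x\<in>U +>\<^bsub>V\<^esub> v. U +>\<^bsub>V\<^esub> f x) = U +>\<^bsub>V\<^esub> f v"
proof -
  have "U +>\<^bsub>V\<^esub> f x = U +>\<^bsub>V\<^esub> f v" if "x \<in> U +>\<^bsub>V\<^esub> v" for x
  proof -
    from that obtain u where u: "u \<in> U" and x: "x = u \<oplus>\<^bsub>V\<^esub> v"
      by (auto simp: a_r_coset_def')
    have "u \<in> carrier V"
      using u U.a_subset by auto
    then have "f x \<oplus>\<^bsub>V\<^esub> \<ominus>\<^bsub>V\<^esub> f v = f u"
      using v f by (simp add: x f_add V.module.M.a_assoc V.module.M.r_neg)
    then show ?thesis
      using coset_eq_iff[of "f x" "f v"] u v f f_U \<open>u \<in> carrier V\<close> by (simp add: x)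
  qed
  then show ?thesis
    using U.a_rcos_self[OF v] by (intro SUP_eq_const) blast+
qed

lemma smult_quotient:
  assumes "a \<in> carrier K" "v \<in> carrier V"
  shows "a \<odot>\<^bsub>quotient_module V U\<^esub> (U +>\<^bsub>V\<^esub> v) = U +>\<^bsub>V\<^esub> (a \<odot>\<^bsub>V\<^esub> v)"
  using assms monoid_submodule Union_cosets[of v "smult V a"] unfolding monoid_submodule_iff
  by (simp add: quotient_module_def V.module.smult_r_distr)

lemma act_quotient:
  assumes "m \<in> carrier M" "v \<in> carrier V"
  shows "act (quotient_module V U) m (U +>\<^bsub>V\<^esub> v) = U +>\<^bsub>V\<^esub> act V m v"
  using assms monoid_submodule Union_cosets[of v "act V m"] unfolding monoid_submodule_iff
  by (simp add: quotient_module_def act_add act_closed)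

lemma monoid_module_quotient: "monoid_module K M (quotient_module V U)"
proof -
  have neg: "\<exists>w\<in>carrier (quotient_module V U). v \<oplus>\<^bsub>quotient_module V U\<^esub> w = \<zero>\<^bsub>quotient_module V U\<^esub>"
    if v: "v \<in> carrier (quotient_module V U)" for v
  proof -
    from v obtain v' where "v' \<in> carrier V" "v = U +>\<^bsub>V\<^esub> v'"
      by (auto simp: carrier_quotient)
    then show ?thesis
      by (intro bexI[of _ "U +>\<^bsub>V\<^esub> (\<ominus>\<^bsub>V\<^esub> v')"])
        (simp_all add: add_quotient coset_in_quotient zero_quotient_coset V.module.M.r_neg)
  qed
  have vs: "vectorspace K (quotient_module V U)"
  proof (rule vs_criteria)
    show "\<forall>v\<in>carrier (quotient_module V U). \<exists>w\<in>carrier (quotient_module V U).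
        v \<oplus>\<^bsub>quotient_module V U\<^esub> w = \<zero>\<^bsub>quotient_module V U\<^esub>"
      using neg by blast
  qed (auto simp: field_axioms carrier_quotient zero_quotient_coset add_quotient smult_quotient
        V.module.smult_assoc1 V.module.smult_l_distr V.module.smult_r_distr V.module.M.a_ac)
  show ?thesis
  proof (intro monoid_module.intro monoid_module_axioms.intro M.monoid_axioms vs,
      unfold carrier_quotient)
  qed (elim imageE, simp add: add_quotient smult_quotient act_quotient act_closed act_add act_smult
        act_one act_mult)+
qed

lemma simple_quotient:
  assumes "U \<noteq> carrier V"
    and maximal: "\<And>W. monoid_submodule K M W V \<Longrightarrow> U \<subseteq> W \<Longrightarrow> W = U \<or> W = carrier V"
  shows "simple_monoid_module K M (quotient_module V U)"
proof -
  interpret Q: monoid_module K M "quotient_module V U"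
    by (rule monoid_module_quotient)
  obtain v where v: "v \<in> carrier V" "v \<notin> U"
    using assms(1) U.a_subset by auto
  have "carrier (quotient_module V U) \<noteq> {\<zero>\<^bsub>quotient_module V U\<^esub>}"
    using coset_in_quotient[OF v(1)] coset_eq_self_iff[OF v(1)] v(2) by (auto simp: zero_quotient)
  moreover have "Y = {\<zero>\<^bsub>quotient_module V U\<^esub>} \<or> Y = carrier (quotient_module V U)"
    if Y: "monoid_submodule K M Y (quotient_module V U)" for Y
  proof -
    \<comment> \<open>The full preimage of Y contains U, so by maximality it is U or everything; Y
      is recovered as its image.\<close>
    define W where "W = {v \<in> carrier V. U +>\<^bsub>V\<^esub> v \<in> Y}"
    have Y_eq: "Y = (\<lambda>v. U +>\<^bsub>V\<^esub> v) ` W"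
      using Y by (auto simp: W_def Q.monoid_submodule_iff carrier_quotient)
    have "monoid_submodule K M W V"
      using Y unfolding W_def monoid_submodule_iff Q.monoid_submodule_iff
      by (auto simp: act_closed zero_quotient_coset
          simp flip: add_quotient smult_quotient act_quotient)
    moreover have "U \<subseteq> W"
      using Y U.a_subset coset_eq_self_iff
      by (metis (no_types, lifting) Q.monoid_submodule_iff W_def mem_Collect_eq subset_iff
          zero_quotient)
    ultimately consider "W = U" | "W = carrier V"
      using maximal by blast
    then show ?thesis
    proof cases
      case 1
      have "U +>\<^bsub>V\<^esub> u = U" if "u \<in> U" for u
        using that U.a_subset coset_eq_self_iff by auto
      then have "Y = {U}"
        using U.zero_closed unfolding Y_eq 1 by (auto simp: image_iff simp del: U.zero_closed)
      then show ?thesis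
        by (simp add: zero_quotient)
    next
      case 2
      then show ?thesis
        by (simp add: Y_eq carrier_quotient)
    qed
  qed
  ultimately show ?thesis
    by (simp add: simple_monoid_module_def Q.monoid_module_axioms)
qed

end

subsection \<open>Composition series\<close>

text \<open>A bounded, strictly monotone measure on subspaces, in the role of their dimension. It is
  the largest size of an independent subset, measured inside the ambient space, so that no subspace
  has to be treated as a vector space of its own.\<close>

lemma (in vectorspace) obtain_subspace_rank:
  assumes "fin_dim"
  obtains r :: "'c set \<Rightarrow> nat"
  where "\<And>W. W \<subseteq> carrier V \<Longrightarrow> r W \<le> dim"
    and "\<And>W W'. subspace K W V \<Longrightarrow> W' \<subseteq> carrier V \<Longrightarrow> W \<subset> W' \<Longrightarrow> r W < r W'"
proof -
  define S where "S W = {card A |A. A \<subseteq> W \<and> lin_indpt A}" for W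
  have bound: "finite A \<and> card A \<le> dim" if "A \<subseteq> W" "lin_indpt A" "W \<subseteq> carrier V" for A W
    using li_le_dim[OF assms, of A] that by auto
  have S_bound: "S W \<subseteq> {..dim}" if "W \<subseteq> carrier V" for W
    using bound that by (auto simp: S_def)
  have S_fin: "finite (S W)" if "W \<subseteq> carrier V" for W
    using S_bound[OF that] finite_subset by blast
  have "lin_indpt {}"
    by (simp add: lin_dep_def)
  then have "card ({} :: 'c set) \<in> S W" for W
    unfolding S_def by blast
  then have S_ne: "S W \<noteq> {}" for W
    by blast
  show thesis
  proof (rule that[of "\<lambda>W. Max (S W)"])
    fix W assume W: "W \<subseteq> carrier V"
    show "Max (S W) \<le> dim"
      using Max_in[OF S_fin[OF W] S_ne] S_bound[OF W] by auto
  next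
    fix W W' assume W: "subspace K W V" and W': "W' \<subseteq> carrier V" and "W \<subset> W'"
    then have W_carrier: "W \<subseteq> carrier V"
      by auto
    then have "Max (S W) \<in> S W"
      using S_fin S_ne by auto
    then obtain A where A: "A \<subseteq> W" "lin_indpt A" "card A = Max (S W)"
      by (auto simp: S_def)
    obtain v where v: "v \<in> W'" "v \<notin> W"
      using \<open>W \<subset> W'\<close> by auto
    \<comment> \<open>Here W must be a subspace: a largest independent subset A of W then spans
      nothing outside W, and any v outside W can be adjoined to it.\<close>
    have "span A \<subseteq> W"
      using W A(1) by (intro span_is_subset) auto
    then have "v \<notin> span A" "v \<notin> A"
      using v A by auto
    then have "lin_indpt (A \<union> {v})"
      using lin_dep_iff_in_span[of A v] A W_carrier W' v by auto
    then have "card (insert v A) \<in> S W'"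
      using A v \<open>W \<subset> W'\<close> unfolding S_def by (intro CollectI exI[of _ "insert v A"]) auto
    then have "card (insert v A) \<le> Max (S W')"
      using S_fin[OF W'] by auto
    then show "Max (S W) < Max (S W')"
      using A \<open>v \<notin> A\<close> bound[OF A(1,2) W_carrier] by simp
  qed
qed

context monoid_module
begin

text \<open>Take a member of least rank. The property is left open because the lemma serves twice:
  for the submodules strictly above a given one, and for the nonzero submodules killed by all
  nonunits.\<close>

lemma obtain_minimal_submodule:
  assumes "V.fin_dim" and "P W" and sub: "\<And>W. P W \<Longrightarrow> monoid_submodule K M W V"
  obtains N where "P N" and "\<And>N'. P N' \<Longrightarrow> N' \<subseteq> N \<Longrightarrow> N' = N"
proof -
  obtain r where r: "\<And>W W'. subspace K W V \<Longrightarrow> W' \<subseteq> carrier V \<Longrightarrow> W \<subset> W' \<Longrightarrow> r W < (r W' :: nat)"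
    using V.obtain_subspace_rank[OF assms(1)] by metis
  obtain N where N: "P N" "\<And>N'. P N' \<Longrightarrow> r N \<le> r N'"
    using ex_has_least_nat[of P W r] assms(2) by auto
  have "N' = N" if "P N'" "N' \<subseteq> N" for N'
  proof (rule ccontr)
    assume "N' \<noteq> N"
    then have "N' \<subset> N"
      using that by blast
    moreover have "subspace K N' V"
      using sub[OF that(1)] by (simp add: monoid_submodule_def)
    moreover have "N \<subseteq> carrier V"
      using sub[OF N(1)] by (simp add: monoid_submodule_iff)
    ultimately have "r N' < r N"
      using r by blast
    then show False
      using N(2)[OF that(1)] by simp
  qed
  then show thesis
    using that N(1) by blast
qed

lemma simple_subquotient:
  assumes A: "monoid_submodule K M A V" and B: "monoid_submodule K M B V" and "A \<subset> B"
    and minimal: "\<And>W. monoid_submodule K M W V \<Longrightarrow> A \<subseteq> W \<Longrightarrow> W \<subseteq> B \<Longrightarrow> W = A \<or> W = B"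
  shows "simple_monoid_module K M (quotient_module (V\<lparr>carrier := B\<rparr>) A)"
proof -
  interpret B: monoid_module K M "V\<lparr>carrier := B\<rparr>"
    by (rule monoid_module_restrict[OF B])
  interpret Q: monoid_quotient K M "V\<lparr>carrier := B\<rparr>" A
    by unfold_locales (use A B \<open>A \<subset> B\<close> monoid_submodule_restrict in auto)
  show ?thesis
    using assms monoid_submodule_restrict[OF B] by (intro Q.simple_quotient) auto
qed

text \<open>Induction on the codimension of U, adding a minimal submodule strictly above U at each
  step. Starting from an arbitrary U allows a prescribed submodule to be placed at the bottom of the
  series later.\<close>

lemma composition_series_above:
  assumes fin: "V.fin_dim" and "monoid_submodule K M U V"
  shows "\<exists>l C. C 0 = U \<and> C l = carrier V \<and> (\<forall>i\<le>l. monoid_submodule K M (C i) V) \<and>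
    (\<forall>i<l. C i \<subseteq> C (Suc i) \<and>
      simple_monoid_module K M (quotient_module (V\<lparr>carrier := C (Suc i)\<rparr>) (C i)))"
proof -
  obtain r where r_le: "\<And>W. W \<subseteq> carrier V \<Longrightarrow> r W \<le> V.dim"
    and r_less: "\<And>W W'. subspace K W V \<Longrightarrow> W' \<subseteq> carrier V \<Longrightarrow> W \<subset> W' \<Longrightarrow> r W < r W'"
    using V.obtain_subspace_rank[OF fin] by metis
  show ?thesis
    using assms(2)
  proof (induction "V.dim - r U" arbitrary: U rule: less_induct)
    case less
    show ?case
    proof (cases "U = carrier V")
      case True
      then show ?thesis
        using less.prems by (intro exI[of _ 0] exI[of _ "\<lambda>_. U"]) auto
    next
      case False
      have U: "subspace K U V"
        using less.prems by (simp add: monoid_submodule_def)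
      have "U \<subset> carrier V"
        using less.prems False by (auto simp: monoid_submodule_iff)
      let ?P = "\<lambda>W. monoid_submodule K M W V \<and> U \<subset> W"
      obtain N where N: "?P N" and min: "\<And>N'. ?P N' \<Longrightarrow> N' \<subseteq> N \<Longrightarrow> N' = N"
        using obtain_minimal_submodule[of ?P "carrier V"] fin \<open>U \<subset> carrier V\<close> monoid_submodule_carrier by blast
      have "N \<subseteq> carrier V"
        using N by (simp add: monoid_submodule_iff)
      then have "V.dim - r N < V.dim - r U"
        using r_less[OF U, of N] r_le[of N] N by auto
      from less.hyps[OF this] N obtain l C where C: "C 0 = N" "C l = carrier V"
        "\<forall>i\<le>l. monoid_submodule K M (C i) V"
        "\<forall>i<l. C i \<subseteq> C (Suc i) \<and>
          simple_monoid_module K M (quotient_module (V\<lparr>carrier := C (Suc i)\<rparr>) (C i))"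
        by blast
      have "simple_monoid_module K M (quotient_module (V\<lparr>carrier := N\<rparr>) U)"
        using less.prems N min by (intro simple_subquotient) auto
      then show ?thesis
        using C N less.prems
        by (intro exI[of _ "Suc l"] exI[of _ "case_nat U C"])
          (auto split: nat.split simp: less_Suc_eq_0_disj le_Suc_eq)
    qed
  qed
qed

end

section \<open>Units of finite monoids and factors of the form Ind(W)\<close>

lemma (in monoid) right_inverse_imp_Unit:
  assumes "finite (carrier G)" "a \<in> carrier G" "b \<in> carrier G" "a \<otimes> b = \<one>"
  shows "a \<in> Units G"
proof -
  \<comment> \<open>Multiplication by a on the left undoes it. On a finite set it is therefore
    surjective, so b also has a right inverse, which must be a.\<close>
  have "inj_on (\<lambda>x. b \<otimes> x) (carrier G)"
    using assms by (intro inj_onI) (metis l_one m_assoc)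
  then have "(\<lambda>x. b \<otimes> x) ` carrier G = carrier G"
    using assms by (intro endo_inj_surj) auto
  then obtain c where c: "c \<in> carrier G" "b \<otimes> c = \<one>"
    using one_closed by (metis imageE)
  then have "c = a"
    using assms by (metis l_one m_assoc r_one)
  then show ?thesis
    using assms c by (auto simp: Units_def)
qed

text \<open>Read contrapositively, the nonunits form a right ideal; this is what makes the vectors
  killed by them stable under M.\<close>

lemma (in monoid) left_factor_Unit:
  assumes "finite (carrier G)" "a \<in> carrier G" "b \<in> carrier G" "a \<otimes> b \<in> Units G"
  shows "a \<in> Units G"
proof (rule right_inverse_imp_Unit[of _ "b \<otimes> inv (a \<otimes> b)"])
  show "a \<otimes> (b \<otimes> inv (a \<otimes> b)) = \<one>"
    using assms by (simp flip: m_assoc)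
qed (use assms in auto)

text \<open>A subspace stable under G is automatically stable under the nonunits, which send
  everything to 0, so M and G have the same submodules in Q.\<close>

lemma simple_monoid_module_units:
  assumes simple: "simple_monoid_module K M Q"
    and zero: "\<And>m v. m \<in> carrier M - Units M \<Longrightarrow> v \<in> carrier Q \<Longrightarrow> act Q m v = \<zero>\<^bsub>Q\<^esub>"
  shows "simple_monoid_module K (units_of M) Q"
proof -
  interpret Q: monoid_module K M Q
    using simple by (simp add: simple_monoid_module_def)
  interpret G: monoid_module K "units_of M" Q
    by (intro monoid_module.intro monoid_module_axioms.intro Q.V.vectorspace_axioms
        group.is_monoid Q.M.units_group; unfold units_of_carrier units_of_mult units_of_one)
      (simp_all add: Q.M.Units_closed Q.act_closed Q.act_add Q.act_smult Q.act_one Q.act_mult)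
  have "monoid_submodule K M U Q" if U: "monoid_submodule K (units_of M) U Q" for U
  proof -
    have "act Q m u \<in> U" if "m \<in> carrier M" "u \<in> U" for m u
    proof (cases "m \<in> Units M")
      case True
      then show ?thesis
        using U that by (simp add: G.monoid_submodule_iff units_of_carrier)
    next
      case False
      then have "act Q m u = \<zero>\<^bsub>Q\<^esub>"
        using U that by (intro zero) (auto simp: G.monoid_submodule_iff)
      then show ?thesis
        using U by (simp add: G.monoid_submodule_iff)
    qed
    then show ?thesis
      using U by (simp add: G.monoid_submodule_iff Q.monoid_submodule_iff)
  qed
  then show ?thesis
    using simple by (auto simp: simple_monoid_module_def G.monoid_module_axioms)
qed

lemma (in monoid_module) has_ind_factorI:
  assumes "finite (carrier M)" and fin: "V.fin_dim"
    and x: "x \<in> carrier V" "x \<noteq> \<zero>\<^bsub>V\<^esub>"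
    and annihilated: "\<And>m. m \<in> carrier M - Units M \<Longrightarrow> act V m x = \<zero>\<^bsub>V\<^esub>"
  shows "has_ind_factor K M V"
proof -
  define Z where "Z = {v \<in> carrier V. \<forall>m\<in>carrier M - Units M. act V m v = \<zero>\<^bsub>V\<^esub>}"
  have Z: "monoid_submodule K M Z V"
  proof -
    have "act V s (act V m v) = \<zero>\<^bsub>V\<^esub>"
      if "s \<in> carrier M - Units M" "m \<in> carrier M" "v \<in> Z" for s m v
    proof -
      have "s \<otimes>\<^bsub>M\<^esub> m \<in> carrier M - Units M"
        using M.left_factor_Unit[OF assms(1), of s m] that by auto
      then have "act V (s \<otimes>\<^bsub>M\<^esub> m) v = \<zero>\<^bsub>V\<^esub>"
        using \<open>v \<in> Z\<close> unfolding Z_def by blast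
      moreover have "v \<in> carrier V"
        using \<open>v \<in> Z\<close> unfolding Z_def by blast
      ultimately show ?thesis
        using that act_mult[of s m v] by simp
    qed
    then show ?thesis
      by (auto simp: monoid_submodule_iff Z_def act_closed act_add act_smult act_zero)
  qed
  let ?P = "\<lambda>W. monoid_submodule K M W V \<and> W \<subseteq> Z \<and> W \<noteq> {\<zero>\<^bsub>V\<^esub>}"
  have "?P Z"
    using Z x annihilated by (auto simp: Z_def)
  then obtain N where N: "?P N" and min: "\<And>N'. ?P N' \<Longrightarrow> N' \<subseteq> N \<Longrightarrow> N' = N"
    using obtain_minimal_submodule[of ?P Z] fin by blast
  \<comment> \<open>The quotient N/0 replaces N itself because composition factors are literally
    quotients, and \<open>has_ind_factor\<close> expects W on the type of cosets.\<close>
  define Q where "Q = quotient_module (V\<lparr>carrier := N\<rparr>) {\<zero>\<^bsub>V\<^esub>}"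
  have sub: "monoid_submodule K M N V" and "N \<subseteq> Z" "\<zero>\<^bsub>V\<^esub> \<in> N" "{\<zero>\<^bsub>V\<^esub>} \<subset> N"
    using N by (auto simp: monoid_submodule_iff)
  have simple: "simple_monoid_module K M Q"
    unfolding Q_def
  proof (rule simple_subquotient[OF monoid_submodule_zero sub \<open>{\<zero>\<^bsub>V\<^esub>} \<subset> N\<close>])
    fix W assume "monoid_submodule K M W V" "W \<subseteq> N"
    then show "W = {\<zero>\<^bsub>V\<^esub>} \<or> W = N"
      using min[of W] \<open>N \<subseteq> Z\<close> by blast
  qed
  interpret N: monoid_module K M "V\<lparr>carrier := N\<rparr>"
    by (rule monoid_module_restrict[OF sub])
  interpret Q: monoid_quotient K M "V\<lparr>carrier := N\<rparr>" "{\<zero>\<^bsub>V\<^esub>}"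
    by unfold_locales (use N.monoid_submodule_zero in simp)
  have zero: "act Q m v = \<zero>\<^bsub>Q\<^esub>" if m: "m \<in> carrier M - Units M" and v_in: "v \<in> carrier Q" for m v
  proof -
    obtain w where "w \<in> N" and v: "v = {\<zero>\<^bsub>V\<^esub>} +>\<^bsub>V\<lparr>carrier := N\<rparr>\<^esub> w"
      using v_in by (auto simp: Q_def Q.carrier_quotient)
    moreover have "act V m w = \<zero>\<^bsub>V\<^esub>"
      using m \<open>w \<in> N\<close> \<open>N \<subseteq> Z\<close> unfolding Z_def by blast
    ultimately show ?thesis
      using m Q.act_quotient[of m w] Q.zero_quotient_coset by (simp add: Q_def)
  qed
  \<comment> \<open>The nonunits already act as 0 on Q, so \<open>Ind\<close> changes nothing on its
    carrier and the identity is an isomorphism.\<close>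
  have iso: "monoid_module_iso K M (Ind M Q) Q"
    unfolding monoid_module_iso_def
    using zero by (intro bexI[of _ id]) (auto simp: Ind_def module_hom_def)
  obtain l C where C: "C 0 = N" "C l = carrier V"
    "\<forall>i\<le>l. monoid_submodule K M (C i) V"
    "\<forall>i<l. C i \<subseteq> C (Suc i) \<and>
      simple_monoid_module K M (quotient_module (V\<lparr>carrier := C (Suc i)\<rparr>) (C i))"
    using composition_series_above[OF fin sub] by blast
  \<comment> \<open>The series from N upwards is shifted by one to make room for 0; the wanted
    factor then has index 0.\<close>
  let ?C = "case_nat {\<zero>\<^bsub>V\<^esub>} C"
  have "monoid_submodule K M (?C i) V" if "i \<le> Suc l" for i
    using that C(3) monoid_submodule_zero by (cases i) auto
  moreover have "?C i \<subseteq> ?C (Suc i) \<and>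
      simple_monoid_module K M (quotient_module (V\<lparr>carrier := ?C (Suc i)\<rparr>) (?C i))"
    if "i < Suc l" for i
    using that C(1,4) simple \<open>{\<zero>\<^bsub>V\<^esub>} \<subset> N\<close> by (cases i) (auto simp: Q_def)
  ultimately have "composition_series K M V (Suc l) ?C"
    unfolding composition_series_def using C(2) by simp
  then have "composition_factor K M (Ind M Q) V"
    unfolding composition_factor_def
    using iso by (intro exI[of _ "Suc l"] exI[of _ ?C] exI[of _ 0]) (simp add: Q_def C(1))
  then show ?thesis
    unfolding has_ind_factor_def
    using simple_monoid_module_units[OF simple zero] by blast
qed

subsection \<open>Tensor powers\<close>

text \<open>The functional is the coordinate at v with respect to a basis that contains v.\<close>

lemma (in vectorspace) obtain_functional:
  assumes fin: "fin_dim" and v: "v \<in> carrier V" "v \<noteq> \<zero>\<^bsub>V\<^esub>"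
  obtains f where "f \<in> carrier V \<rightarrow> carrier K"
    and "\<And>u w. u \<in> carrier V \<Longrightarrow> w \<in> carrier V \<Longrightarrow> f (u \<oplus>\<^bsub>V\<^esub> w) = f u \<oplus>\<^bsub>K\<^esub> f w"
    and "\<And>a w. a \<in> carrier K \<Longrightarrow> w \<in> carrier V \<Longrightarrow> f (a \<odot>\<^bsub>V\<^esub> w) = a \<otimes>\<^bsub>K\<^esub> f w"
    and "f v = \<one>\<^bsub>K\<^esub>"
proof -
  let ?P = "\<lambda>A. A \<subseteq> carrier V \<and> lin_indpt A \<and> v \<in> A"
  have "lin_indpt {}"
    by (simp add: lin_dep_def)
  then have "lin_indpt {v}"
    using lin_dep_iff_in_span[of "{}" v] v by (simp add: span_empty)
  then obtain A where "finite A" and A: "maximal A ?P"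
    using maximal_exists[of ?P dim "{v}"] li_le_dim[OF fin] v by blast
  \<comment> \<open>Every superset of A still contains v, so maximality among independent sets
    through v is maximality among all of them.\<close>
  have "maximal A (\<lambda>S. S \<subseteq> carrier V \<and> lin_indpt S)"
    using A unfolding maximal_def by blast
  then have "basis A"
    by (rule max_li_is_basis)
  have "v \<in> A" "A \<subseteq> carrier V"
    using A by (auto simp: maximal_def)
  define c where "c w = (THE a. a \<in> A \<rightarrow>\<^sub>E carrier K \<and> lincomb a A = w)" for w
  have ex1: "\<exists>!a. a \<in> A \<rightarrow>\<^sub>E carrier K \<and> lincomb a A = w" if "w \<in> carrier V" for w
    using basis_criterion[OF \<open>finite A\<close> \<open>A \<subseteq> carrier V\<close>] \<open>basis A\<close> that by simp
  have c: "c w \<in> A \<rightarrow>\<^sub>E carrier K" "lincomb (c w) A = w" if "w \<in> carrier V" for w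
    using theI'[OF ex1[OF that]] by (simp_all add: c_def)
  \<comment> \<open>Coordinates are unique only among functions that are \<open>undefined\<close>
    off A; restricting to A extends this to arbitrary coefficient functions, such as the pointwise
    sums and multiples below.\<close>
  have c_eq: "c w x = a x" if a: "a \<in> A \<rightarrow> carrier K" "lincomb a A = w" and x: "x \<in> A" for a w x
  proof -
    have w: "w \<in> carrier V"
      using a \<open>A \<subseteq> carrier V\<close> by auto
    have "lincomb (restrict a A) A = w"
      using a \<open>A \<subseteq> carrier V\<close> by (auto cong: lincomb_cong)
    then have "c w = restrict a A"
      using ex1[OF w] c[OF w] a by (auto dest: PiE_restrict)
    then show ?thesis
      using x by simp
  qed
  show thesis
  proof (rule that[of "\<lambda>w. c w v"])
    show "(\<lambda>w. c w v) \<in> carrier V \<rightarrow> carrier K"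
      using c(1) \<open>v \<in> A\<close> by (auto simp: PiE_iff)
  next
    fix u w assume "u \<in> carrier V" "w \<in> carrier V"
    then show "c (u \<oplus>\<^bsub>V\<^esub> w) v = c u v \<oplus>\<^bsub>K\<^esub> c w v"
      using c \<open>finite A\<close> \<open>A \<subseteq> carrier V\<close> \<open>v \<in> A\<close>
      by (intro c_eq[of "\<lambda>x. c u x \<oplus>\<^bsub>K\<^esub> c w x"]) (auto simp: PiE_iff lincomb_sum Pi_iff)
  next
    fix a w assume "a \<in> carrier K" "w \<in> carrier V"
    then show "c (a \<odot>\<^bsub>V\<^esub> w) v = a \<otimes>\<^bsub>K\<^esub> c w v"
      using c \<open>finite A\<close> \<open>A \<subseteq> carrier V\<close> \<open>v \<in> A\<close>
      by (intro c_eq[of "\<lambda>x. a \<otimes>\<^bsub>K\<^esub> c w x"]) (auto simp: PiE_iff lincomb_smult Pi_iff)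
  next
    have "A - {v} \<subseteq> carrier V"
      using \<open>A \<subseteq> carrier V\<close> by auto
    then have "lincomb (\<lambda>x. if x = v then \<one>\<^bsub>K\<^esub> else \<zero>\<^bsub>K\<^esub>) A = v"
      using lincomb_del2[OF \<open>finite A\<close> \<open>A \<subseteq> carrier V\<close>, of "\<lambda>x. if x = v then \<one>\<^bsub>K\<^esub> else \<zero>\<^bsub>K\<^esub>" v]
        lincomb_zero[of "A - {v}" "\<lambda>x. if x = v then \<one>\<^bsub>K\<^esub> else \<zero>\<^bsub>K\<^esub>"] \<open>A \<subseteq> carrier V\<close> \<open>v \<in> A\<close> v
      by auto
    then show "c v v = \<one>\<^bsub>K\<^esub>"
      using c_eq[of "\<lambda>x. if x = v then \<one>\<^bsub>K\<^esub> else \<zero>\<^bsub>K\<^esub>" v v] \<open>v \<in> A\<close> by auto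
  qed
qed

section \<open>The free space on tuples, its linear forms and its relations\<close>

locale tensor_space = monoid_module K M V
  for K :: "('k, 'r) ring_scheme" and M :: "('m, 's) monoid_scheme"
    and V :: "('k, 'm, 'v) monoid_module" +
  fixes n :: nat
begin

abbreviation "F \<equiv> free_tensors K V n"
abbreviation "t \<equiv> tuple_vec K"

lemma tuples_nth: "xs \<in> tuples V n \<Longrightarrow> i < n \<Longrightarrow> xs ! i \<in> carrier V"
  by (auto simp: tuples_def)

lemma tuples_update: "xs \<in> tuples V n \<Longrightarrow> u \<in> carrier V \<Longrightarrow> xs[i := u] \<in> tuples V n"
  by (auto simp: tuples_def dest: subsetD[OF set_update_subset_insert])

lemma tuples_map: "xs \<in> tuples V n \<Longrightarrow> m \<in> carrier M \<Longrightarrow> map (act V m) xs \<in> tuples V n"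
  by (auto simp: tuples_def act_closed)

lemma carrier_F:
  "f \<in> carrier F \<longleftrightarrow> (\<forall>xs. f xs \<in> carrier K) \<and> (\<forall>xs. f xs \<noteq> \<zero>\<^bsub>K\<^esub> \<longrightarrow> xs \<in> tuples V n) \<and>
    finite {xs. f xs \<noteq> \<zero>\<^bsub>K\<^esub>}"
  by (auto simp: free_tensors_def)

lemma zero_F: "\<zero>\<^bsub>F\<^esub> = (\<lambda>xs. \<zero>\<^bsub>K\<^esub>)"
  and add_F: "f \<oplus>\<^bsub>F\<^esub> g = (\<lambda>xs. f xs \<oplus>\<^bsub>K\<^esub> g xs)"
  and smult_F: "a \<odot>\<^bsub>F\<^esub> f = (\<lambda>xs. a \<otimes>\<^bsub>K\<^esub> f xs)"
  by (simp_all add: free_tensors_def)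

lemma add_F_closed:
  assumes "f \<in> carrier F" "g \<in> carrier F"
  shows "f \<oplus>\<^bsub>F\<^esub> g \<in> carrier F"
proof -
  have "{xs. f xs \<oplus>\<^bsub>K\<^esub> g xs \<noteq> \<zero>\<^bsub>K\<^esub>} \<subseteq> {xs. f xs \<noteq> \<zero>\<^bsub>K\<^esub>} \<union> {xs. g xs \<noteq> \<zero>\<^bsub>K\<^esub>}"
    by auto
  then show ?thesis
    using assms unfolding carrier_F add_F
    by (auto intro: finite_subset)
qed

lemma smult_F_closed:
  assumes "a \<in> carrier K" "f \<in> carrier F"
  shows "a \<odot>\<^bsub>F\<^esub> f \<in> carrier F"
proof -
  have "{xs. a \<otimes>\<^bsub>K\<^esub> f xs \<noteq> \<zero>\<^bsub>K\<^esub>} \<subseteq> {xs. f xs \<noteq> \<zero>\<^bsub>K\<^esub>}"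
    using assms by auto
  then show ?thesis
    using assms unfolding carrier_F smult_F by (auto intro: finite_subset)
qed

lemma zero_F_closed: "\<zero>\<^bsub>F\<^esub> \<in> carrier F"
  by (simp add: carrier_F zero_F)

lemma vectorspace_F: "vectorspace K F"
proof (rule vs_criteria)
  show "\<forall>f\<in>carrier F. \<exists>g\<in>carrier F. f \<oplus>\<^bsub>F\<^esub> g = \<zero>\<^bsub>F\<^esub>"
  proof
    fix f assume f: "f \<in> carrier F"
    then have "f \<oplus>\<^bsub>F\<^esub> ((\<ominus>\<^bsub>K\<^esub> \<one>\<^bsub>K\<^esub>) \<odot>\<^bsub>F\<^esub> f) = \<zero>\<^bsub>F\<^esub>"
      by (simp add: carrier_F add_F smult_F zero_F V.module.R.l_minus V.module.R.r_neg)
    then show "\<exists>g\<in>carrier F. f \<oplus>\<^bsub>F\<^esub> g = \<zero>\<^bsub>F\<^esub>"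
      using f by (blast intro: smult_F_closed V.module.R.a_inv_closed V.module.R.one_closed)
  qed
qed (auto simp: field_axioms zero_F_closed add_F_closed smult_F_closed,
    auto simp: add_F smult_F zero_F carrier_F V.module.R.a_ac V.module.R.m_assoc
      V.module.R.l_distr V.module.R.r_distr fun_eq_iff)

lemma tuple_vec_closed: "xs \<in> tuples V n \<Longrightarrow> t xs \<in> carrier F"
  by (auto simp: carrier_F tuple_vec_def)

end

sublocale tensor_space \<subseteq> F: vectorspace K F
  by (rule vectorspace_F)

context tensor_space
begin

text \<open>The tuples span the free space, by induction on a finite set containing the support.
  Statements compatible with the linear structure thus reduce to single tuples.\<close>

lemma free_tensors_induct [consumes 1, case_names zero tuple add smult]:
  assumes f: "f \<in> carrier F"
    and zero: "P \<zero>\<^bsub>F\<^esub>"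
    and tuple: "\<And>xs. xs \<in> tuples V n \<Longrightarrow> P (t xs)"
    and add: "\<And>f g. f \<in> carrier F \<Longrightarrow> g \<in> carrier F \<Longrightarrow> P f \<Longrightarrow> P g \<Longrightarrow> P (f \<oplus>\<^bsub>F\<^esub> g)"
    and smult: "\<And>a f. a \<in> carrier K \<Longrightarrow> f \<in> carrier F \<Longrightarrow> P f \<Longrightarrow> P (a \<odot>\<^bsub>F\<^esub> f)"
  shows "P f"
proof -
  have "\<forall>f\<in>carrier F. {xs. f xs \<noteq> \<zero>\<^bsub>K\<^esub>} \<subseteq> S \<longrightarrow> P f" if "finite S" for S
    using that
  proof (induction S)
    case empty
    then show ?case
      using zero by (auto simp: zero_F)
  next
    case (insert xs S)
    show ?case
    proof (intro ballI impI)
      fix f assume f: "f \<in> carrier F" "{xs. f xs \<noteq> \<zero>\<^bsub>K\<^esub>} \<subseteq> insert xs S"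
      show "P f"
      proof (cases "f xs = \<zero>\<^bsub>K\<^esub>")
        case True
        then have "{xs. f xs \<noteq> \<zero>\<^bsub>K\<^esub>} \<subseteq> S"
          using f(2) by auto
        then show ?thesis
          using insert.IH f(1) by simp
      next
        case False
        let ?g = "f(xs := \<zero>\<^bsub>K\<^esub>)"
        have xs: "xs \<in> tuples V n" "f xs \<in> carrier K"
          using False f(1) by (auto simp: carrier_F)
        have "{ys. ?g ys \<noteq> \<zero>\<^bsub>K\<^esub>} \<subseteq> {ys. f ys \<noteq> \<zero>\<^bsub>K\<^esub>}"
          by auto
        then have g: "?g \<in> carrier F"
          using f(1) unfolding carrier_F by (auto intro: finite_subset)
        moreover have "{ys. ?g ys \<noteq> \<zero>\<^bsub>K\<^esub>} \<subseteq> S"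
          using f(2) by auto
        ultimately have "P ?g"
          using insert.IH by blast
        moreover have "P (f xs \<odot>\<^bsub>F\<^esub> t xs)"
          using xs by (intro smult tuple tuple_vec_closed)
        moreover have "f = ?g \<oplus>\<^bsub>F\<^esub> (f xs \<odot>\<^bsub>F\<^esub> t xs)"
          using f(1) by (auto simp: add_F smult_F carrier_F tuple_vec_def)
        ultimately show ?thesis
          using add[OF g, of "f xs \<odot>\<^bsub>F\<^esub> t xs"] xs by (simp add: smult_F_closed tuple_vec_closed)
      qed
    qed
  qed
  then show ?thesis
    using f carrier_F by blast
qed

text \<open>The universal property of the free space for scalar values: the linear form that takes
  the value \<open>p xs\<close> on the basis vector \<open>t xs\<close>.\<close>

definition extend :: "('v list \<Rightarrow> 'k) \<Rightarrow> ('v list \<Rightarrow> 'k) \<Rightarrow> 'k"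
  where "extend p f = (\<Oplus>\<^bsub>K\<^esub>xs\<in>{xs. f xs \<noteq> \<zero>\<^bsub>K\<^esub>}. f xs \<otimes>\<^bsub>K\<^esub> p xs)"

text \<open>Allows several functions to be summed over one common finite set although their supports
  differ.\<close>

lemma extend_eq:
  assumes "f \<in> carrier F" "p \<in> UNIV \<rightarrow> carrier K" "finite S" "{xs. f xs \<noteq> \<zero>\<^bsub>K\<^esub>} \<subseteq> S"
  shows "extend p f = (\<Oplus>\<^bsub>K\<^esub>xs\<in>S. f xs \<otimes>\<^bsub>K\<^esub> p xs)"
  unfolding extend_def using assms
  by (intro V.module.R.add.finprod_mono_neutral_cong_left) (auto simp: carrier_F Pi_iff)

lemma extend_closed:
  assumes "f \<in> carrier F" "p \<in> UNIV \<rightarrow> carrier K"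
  shows "extend p f \<in> carrier K"
  unfolding extend_def using assms by (intro V.module.R.finsum_closed) (auto simp: carrier_F Pi_iff)

lemma extend_add:
  assumes f: "f \<in> carrier F" and g: "g \<in> carrier F" and p: "p \<in> UNIV \<rightarrow> carrier K"
  shows "extend p (f \<oplus>\<^bsub>F\<^esub> g) = extend p f \<oplus>\<^bsub>K\<^esub> extend p g"
proof -
  let ?S = "{xs. f xs \<noteq> \<zero>\<^bsub>K\<^esub>} \<union> {xs. g xs \<noteq> \<zero>\<^bsub>K\<^esub>}"
  have S: "finite ?S" "{xs. (f \<oplus>\<^bsub>F\<^esub> g) xs \<noteq> \<zero>\<^bsub>K\<^esub>} \<subseteq> ?S"
    using f g by (auto simp: carrier_F add_F)
  have "extend p (f \<oplus>\<^bsub>F\<^esub> g) = (\<Oplus>\<^bsub>K\<^esub>xs\<in>?S. f xs \<otimes>\<^bsub>K\<^esub> p xs \<oplus>\<^bsub>K\<^esub> g xs \<otimes>\<^bsub>K\<^esub> p xs)"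
    unfolding extend_eq[OF add_F_closed[OF f g] p S] using f g p
    by (intro V.module.R.finsum_cong') (auto simp: add_F V.module.R.l_distr carrier_F Pi_iff)
  also have "\<dots> = (\<Oplus>\<^bsub>K\<^esub>xs\<in>?S. f xs \<otimes>\<^bsub>K\<^esub> p xs) \<oplus>\<^bsub>K\<^esub> (\<Oplus>\<^bsub>K\<^esub>xs\<in>?S. g xs \<otimes>\<^bsub>K\<^esub> p xs)"
    using f g p by (intro V.module.R.finsum_addf) (auto simp: carrier_F Pi_iff)
  also have "\<dots> = extend p f \<oplus>\<^bsub>K\<^esub> extend p g"
    using S(1) f g p extend_eq[of f p ?S] extend_eq[of g p ?S] by simp
  finally show ?thesis .
qed

lemma extend_smult:
  assumes a: "a \<in> carrier K" and f: "f \<in> carrier F" and p: "p \<in> UNIV \<rightarrow> carrier K"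
  shows "extend p (a \<odot>\<^bsub>F\<^esub> f) = a \<otimes>\<^bsub>K\<^esub> extend p f"
proof -
  let ?S = "{xs. f xs \<noteq> \<zero>\<^bsub>K\<^esub>}"
  have S: "finite ?S" "{xs. (a \<odot>\<^bsub>F\<^esub> f) xs \<noteq> \<zero>\<^bsub>K\<^esub>} \<subseteq> ?S"
    using a f by (auto simp: carrier_F smult_F)
  have "extend p (a \<odot>\<^bsub>F\<^esub> f) = (\<Oplus>\<^bsub>K\<^esub>xs\<in>?S. a \<otimes>\<^bsub>K\<^esub> (f xs \<otimes>\<^bsub>K\<^esub> p xs))"
    unfolding extend_eq[OF smult_F_closed[OF a f] p S] using a f p
    by (intro V.module.R.finsum_cong') (auto simp: smult_F V.module.R.m_assoc carrier_F Pi_iff)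
  also have "\<dots> = a \<otimes>\<^bsub>K\<^esub> extend p f"
    unfolding extend_def
    by (rule V.module.R.finsum_rdistr[OF S(1) a, symmetric]) (use f p in \<open>auto simp: carrier_F\<close>)
  finally show ?thesis .
qed

lemma extend_tuple_vec:
  assumes "p \<in> UNIV \<rightarrow> carrier K"
  shows "extend p (t xs) = p xs"
proof -
  have "{ys. t xs ys \<noteq> \<zero>\<^bsub>K\<^esub>} = {xs}"
    by (auto simp: tuple_vec_def)
  moreover have "p xs \<in> carrier K"
    using assms by auto
  ultimately show ?thesis
    by (simp add: extend_def tuple_vec_def)
qed

text \<open>Each coefficient of m f is a linear form in f, namely the one that is 1 on the tuples
  mapped to \<open>ys\<close> and 0 on the others. Linearity of the action is then that of
  \<open>extend\<close>.\<close>

lemma act_F: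
  assumes "f \<in> carrier F"
  shows "act F m f ys = extend (\<lambda>xs. if map (act V m) xs = ys then \<one>\<^bsub>K\<^esub> else \<zero>\<^bsub>K\<^esub>) f"
proof -
  have "(\<Oplus>\<^bsub>K\<^esub>xs\<in>{xs. f xs \<noteq> \<zero>\<^bsub>K\<^esub> \<and> map (act V m) xs = ys}. f xs) =
      (\<Oplus>\<^bsub>K\<^esub>xs\<in>{xs. f xs \<noteq> \<zero>\<^bsub>K\<^esub>}.
        f xs \<otimes>\<^bsub>K\<^esub> (if map (act V m) xs = ys then \<one>\<^bsub>K\<^esub> else \<zero>\<^bsub>K\<^esub>))"
    using assms by (intro V.module.R.add.finprod_mono_neutral_cong_left) (auto simp: carrier_F)
  then show ?thesis
    by (simp add: extend_def free_tensors_def)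
qed

lemma act_F_closed:
  assumes m: "m \<in> carrier M" and f: "f \<in> carrier F"
  shows "act F m f \<in> carrier F"
proof -
  have *: "ys \<in> map (act V m) ` {xs. f xs \<noteq> \<zero>\<^bsub>K\<^esub>}" if "act F m f ys \<noteq> \<zero>\<^bsub>K\<^esub>" for ys
  proof (rule ccontr)
    assume "ys \<notin> map (act V m) ` {xs. f xs \<noteq> \<zero>\<^bsub>K\<^esub>}"
    then have empty: "{xs. f xs \<noteq> \<zero>\<^bsub>K\<^esub> \<and> map (act V m) xs = ys} = {}"
      by auto
    have "act F m f ys = \<zero>\<^bsub>K\<^esub>"
      by (simp add: free_tensors_def empty)
    with that show False
      by simp
  qed
  have fin: "finite {ys. act F m f ys \<noteq> \<zero>\<^bsub>K\<^esub>}"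
  proof (rule finite_subset)
    show "{ys. act F m f ys \<noteq> \<zero>\<^bsub>K\<^esub>} \<subseteq> map (act V m) ` {xs. f xs \<noteq> \<zero>\<^bsub>K\<^esub>}"
      using * by blast
    show "finite (map (act V m) ` {xs. f xs \<noteq> \<zero>\<^bsub>K\<^esub>})"
      using f by (simp add: carrier_F)
  qed
  have "act F m f ys \<in> carrier K" for ys
    unfolding act_F[OF f] using f by (intro extend_closed) auto
  moreover have "ys \<in> tuples V n" if "act F m f ys \<noteq> \<zero>\<^bsub>K\<^esub>" for ys
    using *[OF that] f m by (auto simp: carrier_F intro: tuples_map)
  ultimately show ?thesis
    using fin by (simp add: carrier_F)
qed

lemma act_F_add:
  assumes "f \<in> carrier F" "g \<in> carrier F"
  shows "act F m (f \<oplus>\<^bsub>F\<^esub> g) = act F m f \<oplus>\<^bsub>F\<^esub> act F m g"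
  unfolding add_F[of "act F m f"] using assms by (simp add: fun_eq_iff act_F add_F_closed extend_add)

lemma act_F_smult:
  assumes "a \<in> carrier K" "f \<in> carrier F"
  shows "act F m (a \<odot>\<^bsub>F\<^esub> f) = a \<odot>\<^bsub>F\<^esub> act F m f"
  unfolding smult_F[of a "act F m f"] using assms
  by (simp add: fun_eq_iff act_F smult_F_closed extend_smult)

lemma act_F_tuple_vec:
  assumes "xs \<in> tuples V n"
  shows "act F m (t xs) = t (map (act V m) xs)"
  using assms by (auto simp: fun_eq_iff act_F tuple_vec_closed extend_tuple_vec)
    (auto simp: tuple_vec_def)

lemma act_F_zero: "act F m \<zero>\<^bsub>F\<^esub> = \<zero>\<^bsub>F\<^esub>"
  by (simp add: free_tensors_def)

lemma monoid_module_F: "monoid_module K M F"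
proof (intro monoid_module.intro monoid_module_axioms.intro M.monoid_axioms vectorspace_F)
  fix f assume "f \<in> carrier F"
  then show "act F \<one>\<^bsub>M\<^esub> f = f"
  proof (induction rule: free_tensors_induct)
    case (tuple xs)
    then have "map (act V \<one>\<^bsub>M\<^esub>) xs = xs"
      by (auto simp: tuples_def act_one subset_iff intro!: map_idI)
    then show ?case
      using tuple by (simp add: act_F_tuple_vec)
  qed (simp_all add: act_F_zero act_F_add act_F_smult)
next
  fix m m' f assume m: "m \<in> carrier M" "m' \<in> carrier M" and "f \<in> carrier F"
  from this(3) show "act F (m \<otimes>\<^bsub>M\<^esub> m') f = act F m (act F m' f)"
  proof (induction rule: free_tensors_induct)
    case (tuple xs)
    have map: "map (act V (m \<otimes>\<^bsub>M\<^esub> m')) xs = map (act V m) (map (act V m') xs)"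
      using tuple m by (auto simp: tuples_def act_mult)
    show ?case
      using tuple m by (simp add: act_F_tuple_vec tuples_map map del: map_map)
  qed (use m in \<open>simp_all add: act_F_zero act_F_add act_F_smult act_F_closed\<close>)
qed (simp_all add: act_F_closed act_F_add act_F_smult)


lemma submodule_kernel:
  assumes p: "p \<in> UNIV \<rightarrow> carrier K"
  shows "submodule K {f \<in> carrier F. extend p f = \<zero>\<^bsub>K\<^esub>} F"
proof -
  have "extend p \<zero>\<^bsub>F\<^esub> = \<zero>\<^bsub>K\<^esub>"
    by (simp add: extend_def zero_F)
  then show ?thesis
    using p F.module_axioms
    by (auto simp: LinearCombinations.submodule_def extend_add extend_smult)
qed

abbreviation "R \<equiv> multilinear_relations K V n"
abbreviation "I \<equiv> F.span R"

lemma relation_cases: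
  assumes "r \<in> R"
  obtains (add) xs i u v where "xs \<in> tuples V n" "i < n" "u \<in> carrier V" "v \<in> carrier V"
      "r = t (xs[i := u \<oplus>\<^bsub>V\<^esub> v]) \<ominus>\<^bsub>F\<^esub> (t (xs[i := u]) \<oplus>\<^bsub>F\<^esub> t (xs[i := v]))"
  | (smult) xs i a u where "xs \<in> tuples V n" "i < n" "a \<in> carrier K" "u \<in> carrier V"
      "r = t (xs[i := a \<odot>\<^bsub>V\<^esub> u]) \<ominus>\<^bsub>F\<^esub> (a \<odot>\<^bsub>F\<^esub> t (xs[i := u]))"
  using assms unfolding multilinear_relations_def Let_def by blast

lemma relation_add:
  assumes "xs \<in> tuples V n" "i < n" "u \<in> carrier V" "v \<in> carrier V"
  shows "t (xs[i := u \<oplus>\<^bsub>V\<^esub> v]) \<ominus>\<^bsub>F\<^esub> (t (xs[i := u]) \<oplus>\<^bsub>F\<^esub> t (xs[i := v])) \<in> R"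
  using assms unfolding multilinear_relations_def Let_def by blast

lemma relation_smult:
  assumes "xs \<in> tuples V n" "i < n" "a \<in> carrier K" "u \<in> carrier V"
  shows "t (xs[i := a \<odot>\<^bsub>V\<^esub> u]) \<ominus>\<^bsub>F\<^esub> (a \<odot>\<^bsub>F\<^esub> t (xs[i := u])) \<in> R"
  using assms unfolding multilinear_relations_def Let_def by blast

lemma relations_carrier: "R \<subseteq> carrier F"
proof
  fix r assume "r \<in> R"
  then show "r \<in> carrier F"
    by (cases rule: relation_cases)
      (simp_all add: tuple_vec_closed tuples_update smult_F_closed add_F_closed F.module.M.minus_closed)
qed

lemma act_F_minus:
  assumes "m \<in> carrier M" "f \<in> carrier F" "g \<in> carrier F"
  shows "act F m (f \<ominus>\<^bsub>F\<^esub> g) = act F m f \<ominus>\<^bsub>F\<^esub> act F m g"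
proof -
  interpret mod_hom K F F "act F m"
    using assms(1) F.module_axioms
    by (intro mod_hom.intro mod_hom_axioms.intro)
      (auto simp: module_hom_def act_F_closed act_F_add act_F_smult)
  show ?thesis
    using assms by simp
qed

text \<open>As m is linear on V, it turns a relation into the relation of the same kind for the
  images under m, at the same position and with the same scalar.\<close>

lemma act_relation:
  assumes "r \<in> R" "m \<in> carrier M"
  shows "act F m r \<in> R"
  using assms(1)
proof (cases rule: relation_cases)
  case (add xs i u v)
  then show ?thesis
    using assms(2) relation_add[of "map (act V m) xs" i "act V m u" "act V m v"]
    by (simp add: act_F_minus act_F_add act_F_tuple_vec tuple_vec_closed tuples_update tuples_map
        map_update act_add act_closed F.module.M.add.m_closed)
next
  case (smult xs i a u)
  then show ?thesis
    using assms(2) relation_smult[of "map (act V m) xs" i a "act V m u"]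
    by (simp add: act_F_minus act_F_smult act_F_tuple_vec tuple_vec_closed tuples_update tuples_map
        map_update act_smult act_closed smult_F_closed)
qed

lemma monoid_submodule_I: "monoid_submodule K M I F"
proof -
  interpret F': monoid_module K M F
    by (rule monoid_module_F)
  have I: "submodule K I F"
    by (rule F.span_is_submodule[OF relations_carrier])
  have "act F m f \<in> I" if "m \<in> carrier M" "f \<in> I" for m f
  proof -
    \<comment> \<open>The preimage of \<open>I\<close> under m is a submodule; since it contains the
      generators, it contains their span.\<close>
    have "submodule K {f \<in> carrier F. act F m f \<in> I} F"
      using I that(1) act_F_zero
      by (auto simp: LinearCombinations.submodule_def act_F_add act_F_smult)
    moreover have "R \<subseteq> {f \<in> carrier F. act F m f \<in> I}"
      using relations_carrier act_relation that(1) F.in_own_span[OF relations_carrier] by blast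
    ultimately show ?thesis
      using F.span_is_subset that(2) by blast
  qed
  then show ?thesis
    using I vectorspace_F by (simp add: monoid_submodule_def subspace_def)
qed

end

section \<open>The tensor power as a quotient: pure tensors, nonvanishing, finite dimension\<close>

sublocale tensor_space \<subseteq> T: monoid_quotient K M F I
  by (intro monoid_quotient.intro monoid_quotient_axioms.intro monoid_module_F monoid_submodule_I)

context tensor_space
begin

abbreviation "T \<equiv> tensor_power K V n"
abbreviation "tensor xs \<equiv> I +>\<^bsub>F\<^esub> t xs"

lemma monoid_module_tensor_power: "monoid_module K M T"
  unfolding tensor_power_def by (rule T.monoid_module_quotient)

lemma tensor_closed: "xs \<in> tuples V n \<Longrightarrow> tensor xs \<in> carrier T"
  unfolding tensor_power_def by (intro T.coset_in_quotient tuple_vec_closed)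

lemma tensor_add:
  assumes "xs \<in> tuples V n" "i < n" "u \<in> carrier V" "v \<in> carrier V"
  shows "tensor (xs[i := u \<oplus>\<^bsub>V\<^esub> v]) = tensor (xs[i := u]) \<oplus>\<^bsub>T\<^esub> tensor (xs[i := v])"
proof -
  note closed = tuple_vec_closed[OF tuples_update[OF assms(1)]]
  have "t (xs[i := u \<oplus>\<^bsub>V\<^esub> v]) \<ominus>\<^bsub>F\<^esub> (t (xs[i := u]) \<oplus>\<^bsub>F\<^esub> t (xs[i := v])) \<in> I"
    using relation_add[OF assms] F.in_own_span[OF relations_carrier] by blast
  then have "tensor (xs[i := u \<oplus>\<^bsub>V\<^esub> v]) = I +>\<^bsub>F\<^esub> (t (xs[i := u]) \<oplus>\<^bsub>F\<^esub> t (xs[i := v]))"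
    using assms closed by (subst T.coset_eq_iff) (simp_all add: a_minus_def add_F_closed)
  also have "\<dots> = tensor (xs[i := u]) \<oplus>\<^bsub>T\<^esub> tensor (xs[i := v])"
    unfolding tensor_power_def using assms closed by (intro T.add_quotient[symmetric])
  finally show ?thesis .
qed

lemma tensor_smult:
  assumes "xs \<in> tuples V n" "i < n" "a \<in> carrier K" "u \<in> carrier V"
  shows "tensor (xs[i := a \<odot>\<^bsub>V\<^esub> u]) = a \<odot>\<^bsub>T\<^esub> tensor (xs[i := u])"
proof -
  note closed = tuple_vec_closed[OF tuples_update[OF assms(1)]]
  have "t (xs[i := a \<odot>\<^bsub>V\<^esub> u]) \<ominus>\<^bsub>F\<^esub> (a \<odot>\<^bsub>F\<^esub> t (xs[i := u])) \<in> I"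
    using relation_smult[OF assms] F.in_own_span[OF relations_carrier] by blast
  then have "tensor (xs[i := a \<odot>\<^bsub>V\<^esub> u]) = I +>\<^bsub>F\<^esub> (a \<odot>\<^bsub>F\<^esub> t (xs[i := u]))"
    using assms closed by (subst T.coset_eq_iff) (simp_all add: a_minus_def smult_F_closed)
  also have "\<dots> = a \<odot>\<^bsub>T\<^esub> tensor (xs[i := u])"
    unfolding tensor_power_def using assms closed by (intro T.smult_quotient[symmetric])
  finally show ?thesis .
qed

text \<open>Write the zero entry as 0 times the zero vector and pull the scalar 0 out of the
  tensor.\<close>

lemma tensor_zero:
  assumes xs: "xs \<in> tuples V n" and "i < n" "xs ! i = \<zero>\<^bsub>V\<^esub>"
  shows "tensor xs = \<zero>\<^bsub>T\<^esub>"
proof -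
  interpret T': monoid_module K M T
    by (rule monoid_module_tensor_power)
  have "xs = xs[i := \<zero>\<^bsub>K\<^esub> \<odot>\<^bsub>V\<^esub> \<zero>\<^bsub>V\<^esub>]"
    using assms(3) by (metis V.module.R.zero_closed V.module.smult_r_null list_update_id)
  then have "tensor xs = \<zero>\<^bsub>K\<^esub> \<odot>\<^bsub>T\<^esub> tensor (xs[i := \<zero>\<^bsub>V\<^esub>])"
    using tensor_smult[of xs i "\<zero>\<^bsub>K\<^esub>" "\<zero>\<^bsub>V\<^esub>"] assms by simp
  also have "\<dots> = \<zero>\<^bsub>T\<^esub>"
    using xs by (intro T'.V.module.smult_l_null tensor_closed tuples_update V.module.M.zero_closed)
  finally show ?thesis .
qed

lemma act_tensor:
  assumes "m \<in> carrier M" "xs \<in> tuples V n"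
  shows "act T m (tensor xs) = tensor (map (act V m) xs)"
  using assms T.act_quotient[of m "t xs"]
  by (simp add: tensor_power_def act_F_tuple_vec tuple_vec_closed)

lemma tensor_nonzero:
  assumes fin: "V.fin_dim" and xs: "xs \<in> tuples V n"
    and nonzero: "\<And>i. i < n \<Longrightarrow> xs ! i \<noteq> \<zero>\<^bsub>V\<^esub>"
  shows "tensor xs \<noteq> \<zero>\<^bsub>T\<^esub>"
proof -
  define P where "P i f \<longleftrightarrow> f \<in> carrier V \<rightarrow> carrier K \<and>
      (\<forall>u\<in>carrier V. \<forall>w\<in>carrier V. f (u \<oplus>\<^bsub>V\<^esub> w) = f u \<oplus>\<^bsub>K\<^esub> f w) \<and>
      (\<forall>a\<in>carrier K. \<forall>w\<in>carrier V. f (a \<odot>\<^bsub>V\<^esub> w) = a \<otimes>\<^bsub>K\<^esub> f w) \<and>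
      f (xs ! i) = \<one>\<^bsub>K\<^esub>" for i f
  have "\<exists>f. P i f" if "i < n" for i
    using V.obtain_functional[OF fin tuples_nth[OF xs that] nonzero[OF that]]
    unfolding P_def by metis
  then obtain f where "\<And>i. i < n \<Longrightarrow> P i (f i)"
    by metis
  then have f: "\<And>i u. i < n \<Longrightarrow> u \<in> carrier V \<Longrightarrow> f i u \<in> carrier K"
    "\<And>i u w. i < n \<Longrightarrow> u \<in> carrier V \<Longrightarrow> w \<in> carrier V \<Longrightarrow> f i (u \<oplus>\<^bsub>V\<^esub> w) = f i u \<oplus>\<^bsub>K\<^esub> f i w"
    "\<And>i a w. i < n \<Longrightarrow> a \<in> carrier K \<Longrightarrow> w \<in> carrier V \<Longrightarrow> f i (a \<odot>\<^bsub>V\<^esub> w) = a \<otimes>\<^bsub>K\<^esub> f i w"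
    "\<And>i. i < n \<Longrightarrow> f i (xs ! i) = \<one>\<^bsub>K\<^esub>"
    unfolding P_def by blast+
  \<comment> \<open>A product of functionals, one for each factor, gives a linear form on the free space that
    vanishes on the relations of multilinearity but not on the given tuple.\<close>
  define p where
    "p ys = (if ys \<in> tuples V n then \<Otimes>\<^bsub>K\<^esub>i\<in>{..<n}. f i (ys ! i) else \<zero>\<^bsub>K\<^esub>)" for ys
  have p: "p \<in> UNIV \<rightarrow> carrier K"
    using f(1) tuples_nth by (auto simp: p_def intro!: V.module.R.finprod_closed)
  \<comment> \<open>With the other entries fixed, p is the i-th functional times a constant. A
    relation varies only one entry, so linearity of that functional is enough to make it
    vanish.\<close>
  have p_update: "\<exists>c\<in>carrier K. \<forall>u\<in>carrier V. p (ys[i := u]) = f i u \<otimes>\<^bsub>K\<^esub> c"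
    if ys: "ys \<in> tuples V n" and i: "i < n" for ys i
  proof (intro bexI ballI)
    let ?c = "\<Otimes>\<^bsub>K\<^esub>j\<in>{..<n} - {i}. f j (ys ! j)"
    show "?c \<in> carrier K"
      using f(1) tuples_nth[OF ys] by (intro V.module.R.finprod_closed) auto
    fix u assume u: "u \<in> carrier V"
    have "length ys = n"
      using ys by (simp add: tuples_def)
    have "p (ys[i := u]) = (\<Otimes>\<^bsub>K\<^esub>j\<in>insert i ({..<n} - {i}). f j (ys[i := u] ! j))"
      using ys u i by (simp add: p_def tuples_update insert_absorb)
    also have "\<dots> = f i (ys[i := u] ! i) \<otimes>\<^bsub>K\<^esub> (\<Otimes>\<^bsub>K\<^esub>j\<in>{..<n} - {i}. f j (ys[i := u] ! j))"
      using f(1) tuples_nth[OF tuples_update[OF ys u]] i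
      by (intro V.module.R.finprod_insert) auto
    also have "(\<Otimes>\<^bsub>K\<^esub>j\<in>{..<n} - {i}. f j (ys[i := u] ! j)) = ?c"
      using f(1) tuples_nth[OF ys] by (intro V.module.R.finprod_cong') auto
    finally show "p (ys[i := u]) = f i u \<otimes>\<^bsub>K\<^esub> ?c"
      using i \<open>length ys = n\<close> by simp
  qed
  let ?N = "{g \<in> carrier F. extend p g = \<zero>\<^bsub>K\<^esub>}"
  have minus: "g \<ominus>\<^bsub>F\<^esub> h \<in> ?N" if "g \<in> carrier F" "h \<in> carrier F" "extend p g = extend p h" for g h
  proof -
    have "g \<ominus>\<^bsub>F\<^esub> h = g \<oplus>\<^bsub>F\<^esub> (\<ominus>\<^bsub>K\<^esub> \<one>\<^bsub>K\<^esub>) \<odot>\<^bsub>F\<^esub> h"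
      using that by (simp add: a_minus_def F.module.smult_l_minus)
    then show ?thesis
      using that extend_closed[OF that(2) p] p
      by (simp add: extend_add extend_smult smult_F_closed add_F_closed V.module.R.l_minus
          V.module.R.r_neg)
  qed
  have "R \<subseteq> ?N"
  proof
    fix r assume "r \<in> R"
    then show "r \<in> ?N"
    proof (cases rule: relation_cases)
      case (add ys i u v)
      then obtain c where "c \<in> carrier K" "\<And>u. u \<in> carrier V \<Longrightarrow> p (ys[i := u]) = f i u \<otimes>\<^bsub>K\<^esub> c"
        using p_update by metis
      then show ?thesis
        unfolding add(5) using add(1-4) p f(1,2)
        by (intro minus) (simp_all add: extend_add extend_tuple_vec tuple_vec_closed tuples_update
            add_F_closed V.module.R.l_distr)
    next
      case (smult ys i a u)
      then obtain c where "c \<in> carrier K" "\<And>u. u \<in> carrier V \<Longrightarrow> p (ys[i := u]) = f i u \<otimes>\<^bsub>K\<^esub> c"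
        using p_update by metis
      then show ?thesis
        unfolding smult(5) using smult(1-4) p f(1,3)
        by (intro minus) (simp_all add: extend_smult extend_tuple_vec tuple_vec_closed
            tuples_update smult_F_closed V.module.R.m_assoc)
    qed
  qed
  then have "I \<subseteq> ?N"
    by (intro F.span_is_subset submodule_kernel p)
  moreover have "p xs = \<one>\<^bsub>K\<^esub>"
    using xs f(4) by (auto simp: p_def intro!: V.module.R.finprod_one_eqI)
  then have "extend p (t xs) \<noteq> \<zero>\<^bsub>K\<^esub>"
    by (simp add: extend_tuple_vec[OF p])
  ultimately have "t xs \<notin> I"
    by auto
  then show ?thesis
    using T.coset_eq_self_iff[OF tuple_vec_closed[OF xs]]
    by (simp add: tensor_power_def T.zero_quotient)
qed

text \<open>The finitely many tensors with entries in a finite spanning set B of V span the tensor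
  power, since arbitrary entries can be expanded in B one position at a time.\<close>

lemma fin_dim_tensor_power:
  assumes "V.fin_dim"
  shows "vectorspace.fin_dim K T"
proof -
  interpret T': monoid_module K M T
    by (rule monoid_module_tensor_power)
  obtain B where B: "finite B" "B \<subseteq> carrier V" "V.module.span B = carrier V"
    using assms by (auto simp: V.fin_dim_def)
  define A where "A = tensor ` {xs. set xs \<subseteq> B \<and> length xs = n}"
  have "finite A"
    unfolding A_def using B(1) by (intro finite_imageI finite_lists_length_eq)
  have A: "A \<subseteq> carrier T"
    using B(2) by (auto simp: A_def tuples_def intro!: tensor_closed)
  define S where "S = T'.V.module.span A"
  have S: "submodule K S T"
    unfolding S_def by (rule T'.V.module.span_is_submodule[OF A])
  \<comment> \<open>Only the first j entries are arbitrary. For j = 0 the tensor is one of the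
    generators; for j = n there is no restriction left.\<close>
  have "tensor xs \<in> S" if "xs \<in> tuples V n" "\<And>i. j \<le> i \<Longrightarrow> i < n \<Longrightarrow> xs ! i \<in> B" for j xs
    using that
  proof (induction j arbitrary: xs)
    case 0
    then have "length xs = n"
      by (simp add: tuples_def)
    moreover have "set xs \<subseteq> B"
      using 0 \<open>length xs = n\<close> by (auto simp: set_conv_nth)
    ultimately have "tensor xs \<in> A"
      unfolding A_def by blast
    then show ?case
      using T'.V.module.in_own_span[OF A] by (auto simp: S_def)
  next
    case (Suc j)
    show ?case
    proof (cases "j < n")
      case True
      have len: "length xs = n"
        using Suc.prems(1) by (simp add: tuples_def)
      \<comment> \<open>The admissible entries at position j form a subspace by multilinearity; by
        induction it contains B, hence it is V.\<close>
      let ?U = "{u \<in> carrier V. tensor (xs[j := u]) \<in> S}"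
      have "tensor (xs[j := \<zero>\<^bsub>V\<^esub>]) = \<zero>\<^bsub>T\<^esub>"
        using True Suc.prems(1) len by (intro tensor_zero tuples_update) auto
      then have "submodule K ?U V"
        using S Suc.prems(1) True V.module.module_axioms
        by (auto simp: LinearCombinations.submodule_def tensor_add tensor_smult)
      moreover have "B \<subseteq> ?U"
      proof
        fix b assume b: "b \<in> B"
        have "xs[j := b] ! i \<in> B" if "j \<le> i" "i < n" for i
          using that b len Suc.prems(2)[of i] by (cases "i = j") auto
        then show "b \<in> ?U"
          using b B(2) Suc.prems(1) by (auto intro!: Suc.IH tuples_update)
      qed
      ultimately have "V.module.span B \<subseteq> ?U"
        by (intro V.module.span_is_subset)
      then have "xs ! j \<in> ?U"
        using tuples_nth[OF Suc.prems(1) True] B(3) by blast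
      then show ?thesis
        by simp
    next
      case False
      then show ?thesis
        using Suc.prems(1) by (intro Suc.IH) auto
    qed
  qed
  from this[of _ n] have tensor_S: "tensor xs \<in> S" if "xs \<in> tuples V n" for xs
    using that by auto
  have "I +>\<^bsub>F\<^esub> f \<in> S" if "f \<in> carrier F" for f
    using that
  proof (induction rule: free_tensors_induct)
    case zero
    then show ?case
      using S T.zero_quotient_coset by (simp add: LinearCombinations.submodule_def tensor_power_def)
  next
    case (add f g)
    then show ?case
      using S T.add_quotient[of f g]
      by (simp add: LinearCombinations.submodule_def tensor_power_def) metis
  next
    case (smult a f)
    then show ?case
      using S T.smult_quotient[of a f]
      by (simp add: LinearCombinations.submodule_def tensor_power_def) metis
  qed (rule tensor_S)
  then have "carrier T \<subseteq> S"
    by (auto simp: tensor_power_def T.carrier_quotient)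
  moreover have "S \<subseteq> carrier T"
    using S by (simp add: LinearCombinations.submodule_def)
  ultimately show ?thesis
    using \<open>finite A\<close> A unfolding T'.V.fin_dim_def S_def by blast
qed

end

subsection \<open>Nonunits and \<open>\<L>\<close>-classes\<close>

lemma (in monoid_module) killed_by_nonunit:
  assumes "finite (carrier M)"
    and faithful: "\<And>m. m \<in> carrier M \<Longrightarrow> \<forall>v\<in>carrier V. act V m v = v \<Longrightarrow> m = \<one>\<^bsub>M\<^esub>"
    and s: "s \<in> carrier M" "s \<notin> Units M"
  shows "\<exists>v\<in>carrier V. v \<noteq> \<zero>\<^bsub>V\<^esub> \<and> act V s v = \<zero>\<^bsub>V\<^esub>"
proof (rule ccontr)
  assume no_kernel: "\<not> (\<exists>v\<in>carrier V. v \<noteq> \<zero>\<^bsub>V\<^esub> \<and> act V s v = \<zero>\<^bsub>V\<^esub>)"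
  have kernel: "v = \<zero>\<^bsub>V\<^esub>" if "v \<in> carrier V" "act V s v = \<zero>\<^bsub>V\<^esub>" for v
    using that no_kernel by blast
  have inj: "v = w" if "v \<in> carrier V" "w \<in> carrier V" "act V s v = act V s w" for v w
  proof -
    interpret hom: mod_hom K V V "act V s"
      using s(1) V.module.module_axioms
      by (intro mod_hom.intro mod_hom_axioms.intro)
        (auto simp: module_hom_def act_closed act_add act_smult)
    have "act V s (v \<ominus>\<^bsub>V\<^esub> w) = \<zero>\<^bsub>V\<^esub>"
      using that s(1) by (simp add: V.module.M.r_neg act_closed a_minus_def)
    then show ?thesis
      using that kernel[of "v \<ominus>\<^bsub>V\<^esub> w"] by simp
  qed
  have inj_pow: "v = w"
    if "v \<in> carrier V" "w \<in> carrier V" "act V (s [^]\<^bsub>M\<^esub> i) v = act V (s [^]\<^bsub>M\<^esub> i) w"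
    for v w and i :: nat
    using that
  proof (induction i arbitrary: v w)
    case (Suc i)
    have "act V s v = act V s w"
    proof (rule Suc.IH)
      show "act V (s [^]\<^bsub>M\<^esub> i) (act V s v) = act V (s [^]\<^bsub>M\<^esub> i) (act V s w)"
        using Suc.prems s(1) by (simp flip: act_mult)
    qed (use Suc.prems s(1) in \<open>simp_all add: act_closed\<close>)
    then show ?case
      using Suc.prems inj by blast
  qed (simp add: act_one)
  \<comment> \<open>By the pigeonhole principle two powers of s coincide; injectivity allows the
    smaller one to be cancelled in the action on V.\<close>
  have "range (\<lambda>i :: nat. s [^]\<^bsub>M\<^esub> i) \<subseteq> carrier M"
    using s(1) by auto
  then have "finite (range (\<lambda>i :: nat. s [^]\<^bsub>M\<^esub> i))"
    using assms(1) finite_subset by blast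
  then have "\<not> inj (\<lambda>i :: nat. s [^]\<^bsub>M\<^esub> i)"
    using finite_imageD infinite_UNIV_nat by blast
  then obtain i j :: nat where "i < j" and pow: "s [^]\<^bsub>M\<^esub> i = s [^]\<^bsub>M\<^esub> j"
    unfolding inj_on_def by (metis linorder_neqE_nat)
  \<comment> \<open>The gap between the exponents is written \<open>Suc d\<close> so that one factor
    s can be split off: the d-th power of s becomes its inverse.\<close>
  then obtain d where j: "j = i + Suc d"
    using less_imp_Suc_add by force
  have "act V (s [^]\<^bsub>M\<^esub> Suc d) v = v" if "v \<in> carrier V" for v
  proof (rule inj_pow[of _ _ i])
    show "act V (s [^]\<^bsub>M\<^esub> i) (act V (s [^]\<^bsub>M\<^esub> Suc d) v) = act V (s [^]\<^bsub>M\<^esub> i) v"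
      using s(1) that pow unfolding j by (metis M.nat_pow_closed M.nat_pow_mult act_mult)
  qed (use s(1) that in \<open>auto intro!: act_closed simp del: nat_pow_Suc\<close>)
  then have "s [^]\<^bsub>M\<^esub> Suc d = \<one>\<^bsub>M\<^esub>"
    using s(1) by (intro faithful) (auto simp del: nat_pow_Suc)
  then have "s \<in> Units M"
    using s(1) M.right_inverse_imp_Unit[OF assms(1), of s "s [^]\<^bsub>M\<^esub> d"]
    by (metis M.nat_pow_Suc2 M.nat_pow_closed)
  with s(2) show False ..
qed

lemma equiv_L_equiv: "equiv (carrier M) (L_equiv M)"
  by (auto simp: L_equiv_def intro!: equivI refl_onI symI transI)

text \<open>The element y = 1 y lies in My = Mx. As a left multiple of x, it kills every vector that
  x kills.\<close>

lemma (in monoid) L_equiv_left_multiple: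
  assumes "(x, y) \<in> L_equiv G"
  obtains m where "m \<in> carrier G" "y = m \<otimes> x"
proof -
  have y: "y \<in> carrier G" and eq: "carrier G #> x = carrier G #> y"
    using assms by (auto simp: L_equiv_def)
  have "\<one> \<otimes> y \<in> carrier G #> y"
    unfolding r_coset_def by blast
  then have "y \<in> carrier G #> x"
    using y eq by simp
  then show thesis
    using that by (auto simp: r_coset_def)
qed

text \<open>Identifies the one class that contributes no tensor factor, and so accounts for the -1
  in the bound. That a left invertible x is a unit relies on finiteness, applied to its left
  inverse.\<close>

lemma (in monoid) L_class_one:
  assumes "finite (carrier G)"
  shows "L_equiv G `` {\<one>} = Units G"
proof (intro equalityI subsetI)
  fix x assume "x \<in> L_equiv G `` {\<one>}"
  then have x: "(x, \<one>) \<in> L_equiv G"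
    by (auto simp: L_equiv_def)
  then obtain m where m: "m \<in> carrier G" "\<one> = m \<otimes> x"
    by (rule L_equiv_left_multiple)
  have "x \<in> carrier G"
    using x by (simp add: L_equiv_def)
  moreover from this have "m \<in> Units G"
    using m right_inverse_imp_Unit[OF assms] by metis
  ultimately have "x = inv m"
    using m by (metis Units_inv_closed Units_l_inv m_assoc l_one r_one)
  then show "x \<in> Units G"
    using \<open>m \<in> Units G\<close> by simp
next
  fix x assume x: "x \<in> Units G"
  have "y \<in> carrier G #> x" if "y \<in> carrier G" for y
  proof -
    have "y \<otimes> inv x \<otimes> x = y"
      using x that Units_closed[OF x] by (simp add: m_assoc)
    moreover have "y \<otimes> inv x \<in> carrier G"
      using x that by simp
    ultimately show ?thesis
      unfolding r_coset_def by force
  qed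
  then have "carrier G #> x = carrier G #> \<one>"
    using x by (auto simp: r_coset_def)
  then show "x \<in> L_equiv G `` {\<one>}"
    using x by (auto simp: L_equiv_def)
qed

lemma (in monoid_module) has_ind_factor_tensor_power:
  assumes finite: "finite (carrier M)" and fin_dim: "V.fin_dim"
    and faithful: "\<And>m. m \<in> carrier M \<Longrightarrow> \<forall>v\<in>carrier V. act V m v = v \<Longrightarrow> m = \<one>\<^bsub>M\<^esub>"
  shows "has_ind_factor K M (tensor_power K V (card (L_classes M) - 1))"
proof -
  define C where "C = L_classes M - {Units M}"
  have "finite (L_classes M)"
    using finite by (simp add: L_classes_def quotient_def)
  then have "finite C"
    by (simp add: C_def)
  have "Units M \<in> L_classes M"
    using M.L_class_one[OF finite] quotientI[of "\<one>\<^bsub>M\<^esub>" "carrier M" "L_equiv M"]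
    by (simp add: L_classes_def)
  then have card_C: "card C = card (L_classes M) - 1"
    by (simp add: C_def)
  have "\<exists>v\<in>carrier V. v \<noteq> \<zero>\<^bsub>V\<^esub> \<and> (\<forall>s\<in>c. act V s v = \<zero>\<^bsub>V\<^esub>)" if c: "c \<in> C" for c
  proof -
    obtain s where s: "s \<in> carrier M" "c = L_equiv M `` {s}"
      using c by (auto simp: C_def L_classes_def elim: quotientE)
    have "s \<notin> Units M"
    proof
      assume "s \<in> Units M"
      then have "(\<one>\<^bsub>M\<^esub>, s) \<in> L_equiv M"
        using M.L_class_one[OF finite] by auto
      then have "c = Units M"
        using equiv_class_eq[OF equiv_L_equiv] M.L_class_one[OF finite] s(2) by metis
      then show False
        using c by (simp add: C_def)
    qed
    then obtain v where v: "v \<in> carrier V" "v \<noteq> \<zero>\<^bsub>V\<^esub>" "act V s v = \<zero>\<^bsub>V\<^esub>"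
      using killed_by_nonunit[OF finite faithful s(1)] by blast
    have "act V s' v = \<zero>\<^bsub>V\<^esub>" if s': "s' \<in> c" for s'
    proof -
      have "(s, s') \<in> L_equiv M"
        using s' s(2) by simp
      then obtain m where "m \<in> carrier M" "s' = m \<otimes>\<^bsub>M\<^esub> s"
        by (rule M.L_equiv_left_multiple)
      then show ?thesis
        using v s(1) by (simp add: act_mult act_zero)
    qed
    then show ?thesis
      using v by blast
  qed
  then obtain v where v: "\<And>c. c \<in> C \<Longrightarrow> v c \<in> carrier V" "\<And>c. c \<in> C \<Longrightarrow> v c \<noteq> \<zero>\<^bsub>V\<^esub>"
    "\<And>c s. c \<in> C \<Longrightarrow> s \<in> c \<Longrightarrow> act V s (v c) = \<zero>\<^bsub>V\<^esub>"
    by metis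
  \<comment> \<open>The order of the tensor factors is arbitrary; distinctness makes their number
    exactly \<open>card C\<close>.\<close>
  obtain cs where cs: "set cs = C" "distinct cs"
    using finite_distinct_list[OF \<open>finite C\<close>] by blast
  define n where "n = card C"
  have len: "length cs = n"
    using cs distinct_card n_def by metis
  interpret tensor_space K M V n ..
  let ?xs = "map v cs"
  have xs: "?xs \<in> tuples V n"
    using cs v(1) len by (auto simp: tuples_def)
  interpret T: monoid_module K M T
    by (rule monoid_module_tensor_power)
  have "has_ind_factor K M T"
  proof (rule T.has_ind_factorI[OF finite fin_dim_tensor_power[OF fin_dim] tensor_closed[OF xs]])
    have "v (cs ! i) \<noteq> \<zero>\<^bsub>V\<^esub>" if "i < n" for i
      using that len cs(1) by (intro v(2)) auto
    then show "tensor ?xs \<noteq> \<zero>\<^bsub>T\<^esub>"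
      using len by (intro tensor_nonzero[OF fin_dim xs]) auto
  next
    \<comment> \<open>The class of m occurs at some position of \<open>cs\<close>, and m kills the
      entry there, hence the whole tensor.\<close>
    fix m assume m: "m \<in> carrier M - Units M"
    define c where "c = L_equiv M `` {m}"
    have "m \<in> c"
      using m equiv_class_self[OF equiv_L_equiv, of m M] by (simp add: c_def)
    then have "c \<in> C"
      using m by (auto simp: C_def c_def L_classes_def intro: quotientI)
    then obtain i where i: "i < n" "cs ! i = c"
      using cs(1) len by (metis in_set_conv_nth)
    have "act T m (tensor ?xs) = tensor (map (act V m) ?xs)"
      using m xs by (intro act_tensor) auto
    also have "\<dots> = \<zero>\<^bsub>T\<^esub>"
      using m i len v(3)[OF \<open>c \<in> C\<close> \<open>m \<in> c\<close>]
      by (intro tensor_zero[of _ i] tuples_map xs) auto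
    finally show "act T m (tensor ?xs) = \<zero>\<^bsub>T\<^esub>" .
  qed
  then show ?thesis
    by (simp add: n_def card_C)
qed

theorem proposition2p1p14:
  fixes K :: "'k ring"
    and M :: "'m monoid"
    and V :: "('k, 'm, 'v) monoid_module"
  assumes "algebraically_closed K"
    and "monoid M" and "finite (carrier M)"
    and "monoid_module K M V"
    and "vectorspace.fin_dim K V"
    and "carrier V \<noteq> {\<zero>\<^bsub>V\<^esub>}"
    and "\<forall>m\<in>carrier M. (\<forall>v\<in>carrier V. act V m v = v) \<longrightarrow> m = \<one>\<^bsub>M\<^esub>"
  shows "(\<exists>n. has_ind_factor K M (tensor_power K V n)) \<and>
         (LEAST n. has_ind_factor K M (tensor_power K V n)) \<le> card (L_classes M) - 1"
proof -
  \<comment> \<open>This single exponent shows both that the minimum exists and that it is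
    bounded.\<close>
  have "has_ind_factor K M (tensor_power K V (card (L_classes M) - 1))"
    using assms by (intro monoid_module.has_ind_factor_tensor_power) auto
  then show ?thesis
    by (auto intro: Least_le)
qed

end
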